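(* For the Euclidean unit ball $B=\{x\in\mathbb{R}^d: |x|<1\}\subset\mathbb{R}^d$, we have $$\mathcal{D}^{\mathcal{G}}_0(B)=\mathcal{D}(B).$$
   Context: Integrals are with respect to Lebesgue measure on $\mathbb{R}^d$; $\widehat f(s)=\int_{\mathbb{R}^d} f(x)e^{-isx}\,dx$. $A_1\Subset A_2$ means that $A_1$ is a compact subset of $A_2$. For real-valued $f$, $f_+=\max\{f,0\}$, $f_-=\max\{-f,0\}$, and $\operatorname{supp} f=\overline{\{x: f(x)\neq 0\}}$. $f\gg 0$ means that $f$ is positive definite: $\sum_{n,m=1}^N c_n\overline{c_m} f(x_n-x_m)\ge 0$ for all $N\in\mathbb{N}$, $x_1,\dots,x_N\in\mathbb{R}^d$, $c_1,\dots,c_N\in\mathbb{C}$. All functions $f$ below are real-valued. $$\mathcal{D}(B):=\sup\Big\{\int_{\mathbb{R}^d} f: f\in C(\mathbb{R}^d),\ f\gg 0,\ f(0)=1,\ \operatorname{supp} f_+\Subset B,\ \operatorname{supp} f_-\Subset\mathbb{R}^d\Big\}.$$ (The same value is obtained if one takes the supremum over $f\in C(\mathbb{R}^d)\cap L^1(\mathbb{R}^d)$ with $f\gg0$, $f(0)=1$, $\operatorname{supp} f_+\subset B$.) $$\mathcal{G}_0(B):=\{f\in C(\mathbb{R}^d)\cap L^1(\mathbb{R}^d): f\gg 0,\ f(0)=1,\ \operatorname{supp} f_+\subset B,\ \operatorname{supp}\widehat f\Subset\mathbb{R}^d\},$$ $$\mathcal{D}^{\mathcal{G}}_0(B):=\sup\Big\{\int_{\mathbb{R}^d}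 f: f\in\mathcal{G}_0(B)\Big\}.$$ *)

theory Defs
  imports "HOL-Analysis.Analysis"
begin

(* Closed support; HOL-Analysis only has support_on, which does not take the closure. *)
definition supp :: "('a::topological_space \<Rightarrow> 'b::zero) \<Rightarrow> 'a set" where
  "supp f = closure {x. f x \<noteq> 0}"

definition pos_part :: "('a \<Rightarrow> real) \<Rightarrow> 'a \<Rightarrow> real" where
  "pos_part f = (\<lambda>x. max (f x) 0)"

definition neg_part :: "('a \<Rightarrow> real) \<Rightarrow> 'a \<Rightarrow> real" where
  "neg_part f = (\<lambda>x. max (- f x) 0)"

(* The coefficients are complex, so membership in the nonnegative reals also asserts that the
   double sum is real. *)
definition positive_definite :: "('a::ab_group_add \<Rightarrow> real) \<Rightarrow> bool" where
  "positive_definite f \<longleftrightarrow>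
     (\<forall>(N::nat) (x :: nat \<Rightarrow> 'a) (c :: nat \<Rightarrow> complex).
        (\<Sum>n=1..N. \<Sum>m=1..N. c n * cnj (c m) * complex_of_real (f (x n - x m))) \<in> \<real>\<^sub>\<ge>\<^sub>0)"

definition fourier :: "('a::euclidean_space \<Rightarrow> real) \<Rightarrow> 'a \<Rightarrow> complex" where
  "fourier f s = (LINT x|lborel. complex_of_real (f x) * exp (- (\<i> * complex_of_real (s \<bullet> x))))"

definition delsarte_class :: "'a::euclidean_space set \<Rightarrow> ('a \<Rightarrow> real) set" where
  "delsarte_class B =
     {f. continuous_on UNIV f \<and> positive_definite f \<and> f 0 = 1 \<and>
         compact (supp (pos_part f)) \<and> supp (pos_part f) \<subseteq> B \<and>
         compact (supp (neg_part f))}"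

(* The suprema are taken in ereal, so that they are meaningful without first knowing that the
   classes are nonempty and the integrals bounded above; the supremum of the empty set is
   -\<infinity>. *)
definition delsarte_const :: "'a::euclidean_space set \<Rightarrow> ereal" where
  "delsarte_const B = (SUP f\<in>delsarte_class B. ereal (LINT x|lborel. f x))"

definition bandlimited_delsarte_class :: "'a::euclidean_space set \<Rightarrow> ('a \<Rightarrow> real) set" where
  "bandlimited_delsarte_class B =
     {f. continuous_on UNIV f \<and> integrable lborel f \<and> positive_definite f \<and> f 0 = 1 \<and>
         supp (pos_part f) \<subseteq> B \<and> compact (supp (fourier f))}"

definition bandlimited_delsarte_const :: "'a::euclidean_space set \<Rightarrow> ereal" where
  "bandlimited_delsarte_const B =
     (SUP f\<in>bandlimited_delsarte_class B. ereal (LINT x|lborel. f x))"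

end

theory Submission
  imports Defs "HOL-Probability.Probability"
begin

text \<open>
  Both inequalities are approximation arguments.

  \<^emph>\<open>Bandlimited at most Delsarte.\<close> Multiply a bandlimited admissible \<open>f\<close> by the tent function
  \<open>\<Prod>\<^sub>b max 0 (1 - \<bar>x\<^sub>b\<bar> / R)\<close>. The tent is the normalised overlap of a cube with its translate by
  \<open>x\<close>, so multiplication by it preserves positive definiteness
  (\<open>positive_definite_mult_tent\<close>); it does not change signs, and it makes the support compact. By
  dominated convergence the integrals tend to the integral of \<open>f\<close> as \<open>R\<close> grows
  (\<open>bandlimited_le_delsarte\<close>).

  \<^emph>\<open>Delsarte at most bandlimited.\<close> Let \<open>f\<close> be admissible with compact support, positive only in a
  ball of radius \<open>r < 1\<close>. Convolving \<open>f\<close> with a nonnegative kernel \<open>peak a\<close> whose transform is a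
  compactly supported positive measure gives a bandlimited function; it is positive definite
  because the transform of \<open>f\<close> is nonnegative (\<open>fourier_nonneg\<close>, \<open>positive_definite_convolve\<close>).
  The convolution may however be slightly positive outside the unit ball. This is repaired by adding
  a small multiple \<open>\<eta>\<close> of one fixed bandlimited positive definite integrable function, the
  \<open>barrier\<close>, which for \<open>\<bar>x\<bar> \<ge> 1/2\<close> lies below a negative multiple of
  \<open>\<Prod>\<^sub>b (1 + x\<^sub>b\<^sup>2)\<^sup>-\<^sup>2\<close> (\<open>barrier_le\<close>). The kernel is chosen to decay faster
  than that, so after normalisation its tail is dominated by the barrier once the concentration
  parameter \<open>a\<close> is large (\<open>peak_far_le\<close>, \<open>convolve_peak_far_le\<close>). The integral of the sum is
  \<open>\<integral>f + \<eta> \<integral>barrier\<close> and its value at \<open>0\<close> is at most \<open>1 + \<eta> barrier 0\<close>; now let \<open>\<eta>\<close> tend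
  to \<open>0\<close>.

  All explicit functions are built from the transform \<open>V\<close> of the cosine restricted to
  \<open>[-\<pi>/2, \<pi>/2]\<close>, which satisfies \<open>(1 - x\<^sup>2) V x = 2 cos (\<pi> x / 2)\<close>. This identity
  displays \<open>(1 - x\<^sup>2) (V x)\<^sup>2\<close> as a product of two positive definite functions, although it is
  nonpositive for \<open>\<bar>x\<bar> \<ge> 1\<close>. Summing such factors over the coordinates gives the negative sign of the
  barrier outside a ball, as in the extremal functions of Gorbachev and Yudin. Those have zeros;
  adding the dilates by \<open>1\<close> and \<open>2\<close> removes them, since \<open>cos t\<close> and \<open>cos (2 t)\<close> never vanish
  together.
\<close>

section \<open>Positive semidefinite kernels\<close>

text \<open>
  A complex kernel is positive semidefinite when all its finite Gram sums are nonnegative reals. The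
  points may repeat and \<open>N\<close> may be \<open>0\<close>. Positive definiteness of a function is the special case of
  a difference kernel (\<open>positive_definite_iff_psd_kernel\<close>).
\<close>

definition psd_kernel :: "('b \<Rightarrow> 'b \<Rightarrow> complex) \<Rightarrow> bool" where
  "psd_kernel k \<longleftrightarrow>
     (\<forall>(N::nat) x c. (\<Sum>n=1..N. \<Sum>m=1..N. c n * cnj (c m) * k (x n) (x m)) \<in> \<real>\<^sub>\<ge>\<^sub>0)"

lemma borel_measurable_cnj [measurable]: "cnj \<in> borel_measurable borel"
  by (intro borel_measurable_continuous_onI continuous_intros)

lemma positive_definite_iff_psd_kernel:
  "positive_definite f \<longleftrightarrow> psd_kernel (\<lambda>x y. complex_of_real (f (x - y)))"
  by (simp add: positive_definite_def psd_kernel_def)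

lemma integral_in_nonneg_Reals:
  fixes g :: "'b \<Rightarrow> complex"
  assumes "\<And>t. g t \<in> \<real>\<^sub>\<ge>\<^sub>0"
  shows "integral\<^sup>L M g \<in> \<real>\<^sub>\<ge>\<^sub>0"
proof -
  have "g = (\<lambda>t. complex_of_real (Re (g t)))"
    using assms by (auto simp: complex_nonneg_Reals_iff complex_eq_iff)
  then have "integral\<^sup>L M g = complex_of_real (integral\<^sup>L M (\<lambda>t. Re (g t)))"
    by (metis integral_complex_of_real)
  moreover have "integral\<^sup>L M (\<lambda>t. Re (g t)) \<ge> 0"
    using assms by (intro integral_nonneg_AE) (auto simp: complex_nonneg_Reals_iff)
  ultimately show ?thesis by simp
qed

lemma psd_kernel_finite_sum:
  assumes "psd_kernel k" and A: "finite A"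
  shows "(\<Sum>a\<in>A. \<Sum>b\<in>A. c a * cnj (c b) * k a b) \<in> \<real>\<^sub>\<ge>\<^sub>0"
proof -
  obtain h where h: "bij_betw h {1..card A} A"
    using ex_bij_betw_nat_finite_1[OF A] by blast
  have "(\<Sum>a\<in>A. \<Sum>b\<in>A. c a * cnj (c b) * k a b) =
        (\<Sum>n=1..card A. \<Sum>m=1..card A. (c (h n)) * cnj (c (h m)) * k (h n) (h m))"
    by (simp add: sum.reindex_bij_betw[OF h, symmetric])
  also have "\<dots> \<in> \<real>\<^sub>\<ge>\<^sub>0"
    using assms(1) unfolding psd_kernel_def
    by (elim allE[where x="card A"] allE[where x=h] allE[where x="\<lambda>n. c (h n)"])
  finally show ?thesis .
qed

lemma psd_kernel_const: "psd_kernel (\<lambda>x y. 1)"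
proof -
  have "(\<Sum>n=1..N. \<Sum>m=1..N. c n * cnj (c m) * 1) = complex_of_real ((cmod (\<Sum>n=1..N. c n))\<^sup>2)"
    for N :: nat and c :: "nat \<Rightarrow> complex"
    unfolding complex_norm_square by (simp add: sum_product)
  then show ?thesis unfolding psd_kernel_def by simp
qed

lemma psd_kernel_mult_rank_one:
  assumes "psd_kernel k"
  shows "psd_kernel (\<lambda>x y. h x * cnj (h y) * k x y)"
  unfolding psd_kernel_def
proof (intro allI)
  fix N :: nat and x :: "nat \<Rightarrow> 'a" and c :: "nat \<Rightarrow> complex"
  have "(\<Sum>n=1..N. \<Sum>m=1..N. (c n * h (x n)) * cnj (c m * h (x m)) * k (x n) (x m)) \<in> \<real>\<^sub>\<ge>\<^sub>0"
    using assms unfolding psd_kernel_def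
    by (elim allE[where x=N] allE[where x=x] allE[where x="\<lambda>n. c n * h (x n)"])
  then show "(\<Sum>n=1..N. \<Sum>m=1..N. c n * cnj (c m) * (h (x n) * cnj (h (x m)) * k (x n) (x m))) \<in> \<real>\<^sub>\<ge>\<^sub>0"
    by (simp add: mult_ac)
qed

lemma psd_kernel_integral:
  assumes "\<And>t. psd_kernel (k t)" and int: "\<And>x y. integrable M (\<lambda>t. k t x y)"
  shows "psd_kernel (\<lambda>x y. LINT t|M. k t x y)"
  unfolding psd_kernel_def
proof (intro allI)
  fix N :: nat and x :: "nat \<Rightarrow> 'b" and c :: "nat \<Rightarrow> complex"
  have "(\<Sum>n=1..N. \<Sum>m=1..N. c n * cnj (c m) * (LINT t|M. k t (x n) (x m))) =
        (LINT t|M. (\<Sum>n=1..N. \<Sum>m=1..N. c n * cnj (c m) * k t (x n) (x m)))"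
    by (simp add: Bochner_Integration.integral_sum int)
  also have "\<dots> \<in> \<real>\<^sub>\<ge>\<^sub>0"
    using assms(1) by (intro integral_in_nonneg_Reals) (auto simp: psd_kernel_def)
  finally show "(\<Sum>n=1..N. \<Sum>m=1..N. c n * cnj (c m) * (LINT t|M. k t (x n) (x m))) \<in> \<real>\<^sub>\<ge>\<^sub>0" .
qed

lemma positive_definite_add:
  assumes "positive_definite f" "positive_definite g"
  shows "positive_definite (\<lambda>x. f x + g x)"
  using assms unfolding positive_definite_def
  by (auto simp: ring_distribs sum.distrib intro!: nonneg_Reals_add_I)

lemma positive_definite_scale:
  assumes "positive_definite f" "a \<ge> 0"
  shows "positive_definite (\<lambda>x. a * f x)"
  unfolding positive_definite_def
proof (intro allI)
  fix N :: nat and x :: "nat \<Rightarrow> 'a" and c :: "nat \<Rightarrow> complex"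
  have "(\<Sum>n=1..N. \<Sum>m=1..N. c n * cnj (c m) * complex_of_real (a * f (x n - x m))) =
      complex_of_real a * (\<Sum>n=1..N. \<Sum>m=1..N. c n * cnj (c m) * complex_of_real (f (x n - x m)))"
    by (simp add: sum_distrib_left mult_ac)
  then show "(\<Sum>n=1..N. \<Sum>m=1..N. c n * cnj (c m) * complex_of_real (a * f (x n - x m))) \<in> \<real>\<^sub>\<ge>\<^sub>0"
    using assms by (auto simp: positive_definite_def intro!: nonneg_Reals_mult_I)
qed

lemma positive_definite_abs_le:
  assumes "positive_definite f"
  shows "\<bar>f x\<bar> \<le> f 0"
proof -
  have two: "c1 * cnj c1 * of_real (f 0) + c1 * cnj c2 * of_real (f x) +
      (c2 * cnj c1 * of_real (f (- x)) + c2 * cnj c2 * of_real (f 0)) \<in> \<real>\<^sub>\<ge>\<^sub>0" for c1 c2 :: complex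
  proof -
    let ?x = "\<lambda>n::nat. if n = 1 then x else 0" and ?c = "\<lambda>n::nat. if n = 1 then c1 else c2"
    have "(\<Sum>n=1..2. \<Sum>m=1..2. ?c n * cnj (?c m) * complex_of_real (f (?x n - ?x m))) \<in> \<real>\<^sub>\<ge>\<^sub>0"
      using assms unfolding positive_definite_def
      by (elim allE[where x=2] allE[where x="?x"] allE[where x="?c"])
    then show ?thesis by (simp add: numeral_2_eq_2 sum.nat_ivl_Suc' add_ac)
  qed
  \<comment> \<open>imaginary coefficients are needed here: the sum is real only if \<open>f\<close> is even\<close>
  have even: "f (- x) = f x"
    using two[of 1 \<i>] by (simp add: complex_nonneg_Reals_iff)
  show ?thesis
    using two[of 1 1] two[of 1 "-1"] by (simp add: complex_nonneg_Reals_iff even abs_if)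
qed

lemma positive_definite_zero_nonneg: "positive_definite f \<Longrightarrow> f 0 \<ge> 0"
  using positive_definite_abs_le[of f 0] by linarith

text \<open>
  The continuous form of positive semidefiniteness. The identity of the space is a pointwise limit of
  simple functions \<open>X\<^sub>i\<close>; replacing \<open>k x y\<close> by \<open>k (X\<^sub>i x) (X\<^sub>i y)\<close> turns the double integral into
  a finite Gram sum whose coefficients are the integrals of \<open>h\<close> over the level sets of \<open>X\<^sub>i\<close>.
\<close>

lemma psd_kernel_double_integral:
  fixes k :: "'a::euclidean_space \<Rightarrow> 'a \<Rightarrow> complex"
  assumes psd: "psd_kernel k" and cont: "continuous_on UNIV (\<lambda>(x, y). k x y)"
    and bound: "\<And>x y. norm (k x y) \<le> C" and h: "integrable lborel h"
  shows "(LINT x|lborel. LINT y|lborel. h x * cnj (h y) * k x y) \<in> \<real>\<^sub>\<ge>\<^sub>0"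
proof -
  obtain X :: "nat \<Rightarrow> 'a \<Rightarrow> 'a" where X: "\<And>i. simple_function lborel (X i)"
    and lim: "\<And>x. (\<lambda>i. X i x) \<longlonglongrightarrow> x"
    using borel_measurable_implies_sequence_metric[of "\<lambda>x. x" "lborel :: 'a measure" 0] by auto
  have C: "C \<ge> 0" using order_trans[OF norm_ge_zero bound] .
  have hm[measurable]: "h \<in> borel_measurable borel" using h by (simp add: borel_measurable_integrable)
  have Xm[measurable]: "X i \<in> borel_measurable borel" for i
    using borel_measurable_simple_function[OF X[of i]] by simp
  have km[measurable]: "(\<lambda>(x, y). k x y) \<in> borel_measurable (borel \<Otimes>\<^sub>M borel)"
    using borel_measurable_continuous_onI[OF cont] by (simp add: borel_prod)
  have cm[measurable]: "(\<lambda>y. cnj (h y)) \<in> borel_measurable borel" by measurable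
  have hint: "integrable lborel (\<lambda>y. norm (h y))" using h by (rule integrable_norm)
  have klim: "(\<lambda>i. k (X i x) (X i y)) \<longlonglongrightarrow> k x y" for x y
    using continuous_on_tendsto_compose[OF cont tendsto_Pair[OF lim[of x] lim[of y]]] by auto
  have inner: "(\<lambda>i. LINT y|lborel. h x * cnj (h y) * k (X i x) (X i y))
      \<longlonglongrightarrow> (LINT y|lborel. h x * cnj (h y) * k x y)" for x
  proof (rule integral_dominated_convergence[where w="\<lambda>y. norm (h x) * C * norm (h y)"])
    show "AE y in lborel. norm (h x * cnj (h y) * k (X i x) (X i y)) \<le> norm (h x) * C * norm (h y)" for i
    proof (rule AE_I2)
      fix y
      have "norm (h x) * norm (h y) * norm (k (X i x) (X i y)) \<le> norm (h x) * norm (h y) * C"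
        by (intro mult_left_mono bound) auto
      then show "norm (h x * cnj (h y) * k (X i x) (X i y)) \<le> norm (h x) * C * norm (h y)"
        by (simp add: norm_mult mult_ac)
    qed
    show "AE y in lborel. (\<lambda>i. h x * cnj (h y) * k (X i x) (X i y)) \<longlonglongrightarrow> h x * cnj (h y) * k x y"
      by (intro AE_I2 tendsto_intros klim)
  qed (use hint in \<open>auto intro!: integrable_mult_right\<close>)
  have outer: "(\<lambda>i. LINT x|lborel. LINT y|lborel. h x * cnj (h y) * k (X i x) (X i y))
      \<longlonglongrightarrow> (LINT x|lborel. LINT y|lborel. h x * cnj (h y) * k x y)"
  proof (rule integral_dominated_convergence[where w="\<lambda>x. norm (h x) * (C * (LINT y|lborel. norm (h y)))"])
    show "AE x in lborel. norm (LINT y|lborel. h x * cnj (h y) * k (X i x) (X i y))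
        \<le> norm (h x) * (C * (LINT y|lborel. norm (h y)))" for i
    proof (rule AE_I2)
      fix x
      have le: "norm (h x * cnj (h y) * k (X i x) (X i y)) \<le> norm (h x) * C * norm (h y)" for y
      proof -
        have "norm (h x) * norm (h y) * norm (k (X i x) (X i y)) \<le> norm (h x) * norm (h y) * C"
          by (intro mult_left_mono bound) auto
        then show ?thesis by (simp add: norm_mult mult_ac)
      qed
      have int: "integrable lborel (\<lambda>y. norm (h x) * C * norm (h y))"
        using hint by (intro integrable_mult_right)
      have "integrable lborel (\<lambda>y. h x * cnj (h y) * k (X i x) (X i y))"
        using order_trans[OF le abs_ge_self]
        by (intro Bochner_Integration.integrable_bound[OF int] AE_I2) auto
      then have "norm (LINT y|lborel. h x * cnj (h y) * k (X i x) (X i y))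
          \<le> (LINT y|lborel. norm (h x) * C * norm (h y))"
        using int le by (rule Bochner_Integration.integral_norm_bound_integral)
      then show "norm (LINT y|lborel. h x * cnj (h y) * k (X i x) (X i y))
        \<le> norm (h x) * (C * (LINT y|lborel. norm (h y)))" by (simp add: mult_ac)
    qed
    show "AE x in lborel. (\<lambda>i. LINT y|lborel. h x * cnj (h y) * k (X i x) (X i y))
      \<longlonglongrightarrow> (LINT y|lborel. h x * cnj (h y) * k x y)"
      by (intro AE_I2 inner)
  qed (use hint in \<open>auto intro!: integrable_mult_left\<close>)
  have "(LINT x|lborel. LINT y|lborel. h x * cnj (h y) * k (X i x) (X i y)) \<in> \<real>\<^sub>\<ge>\<^sub>0" for i
  proof -
    let ?A = "range (X i)"
    have A: "finite ?A" using simple_functionD(1)[OF X[of i]] by simp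
    \<comment> \<open>the part of \<open>h\<close> on the level set of \<open>X i\<close> at \<open>a\<close>\<close>
    define H where "H a y = (if X i y = a then h y else 0)" for a y
    have Xs: "{y. X i y = a} \<in> sets borel" for a
      by measurable
    have Hi: "integrable lborel (H a)" for a
      using integrable_mult_indicator[of "{y. X i y = a}" lborel h] Xs[of a] h
      by (simp add: H_def[abs_def] indicator_def of_bool_def if_distrib[of "\<lambda>r. r *\<^sub>R _"] cong: if_cong)
    have split: "h x * cnj (h y) * k (X i x) (X i y) = (\<Sum>a\<in>?A. \<Sum>b\<in>?A. H a x * (cnj (H b y) * k a b))" for x y
    proof -
      have "(\<Sum>a\<in>?A. \<Sum>b\<in>?A. H a x * (cnj (H b y) * k a b))
        = (\<Sum>a\<in>?A. \<Sum>b\<in>?A. if X i y = b then (if X i x = a then h x * (cnj (h y) * k a b) else 0) else 0)"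
        by (intro sum.cong refl) (auto simp: H_def)
      also have "\<dots> = h x * cnj (h y) * k (X i x) (X i y)"
        using A by (simp add: sum.delta')
      finally show ?thesis by simp
    qed
    have "(LINT x|lborel. LINT y|lborel. h x * cnj (h y) * k (X i x) (X i y)) =
       (\<Sum>a\<in>?A. \<Sum>b\<in>?A. integral\<^sup>L lborel (H a) * cnj (integral\<^sup>L lborel (H b)) * k a b)"
      unfolding split
      by (simp add: Bochner_Integration.integral_sum Hi mult.assoc)
    also have "\<dots> \<in> \<real>\<^sub>\<ge>\<^sub>0"
      using psd_kernel_finite_sum[OF psd A] .
    finally show ?thesis .
  qed
  then show ?thesis
    by (intro closed_sequentially[OF closed_nonneg_Reals_complex _ outer]) auto
qed

lemma lborel_distr_uminus_euclidean: "distr lborel borel uminus = (lborel :: 'a::euclidean_space measure)"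
  using lborel_affine_euclidean[where c="\<lambda>_::'a. -1" and t=0]
  by (simp add: sum_negf euclidean_representation density_1)

lemma lborel_integral_diff:
  fixes g :: "'a::euclidean_space \<Rightarrow> 'b::{banach, second_countable_topology}"
  assumes [measurable]: "g \<in> borel_measurable borel"
  shows "(LINT y|lborel. g (x - y)) = (LINT y|lborel. g y)"
proof -
  have "(LINT y|lborel. g y) = (LINT y|distr lborel borel ((+) x). g y)"
    by (simp add: lborel_distr_plus)
  also have "\<dots> = (LINT y|lborel. g (x + y))"
    by (subst integral_distr) auto
  also have "\<dots> = (LINT y|distr lborel borel uminus. g (x + y))"
    by (simp add: lborel_distr_uminus_euclidean)
  also have "\<dots> = (LINT y|lborel. g (x - y))"
    by (subst integral_distr) auto
  finally show ?thesis ..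
qed

lemma lborel_integrable_diff:
  fixes g :: "'a::euclidean_space \<Rightarrow> 'b::{banach, second_countable_topology}"
  assumes g: "integrable lborel g"
  shows "integrable lborel (\<lambda>y. g (x - y))"
proof -
  have [measurable]: "g \<in> borel_measurable borel" using g by auto
  have "integrable (distr lborel borel ((+) x)) g"
    using g by (simp add: lborel_distr_plus)
  then have "integrable lborel (\<lambda>y. g (x + y))"
    by (subst (asm) integrable_distr_eq) auto
  then have "integrable (distr lborel borel uminus) (\<lambda>y. g (x + y))"
    by (simp add: lborel_distr_uminus_euclidean)
  then show ?thesis
    by (subst (asm) integrable_distr_eq) auto
qed

lemma integrable_indicator_cbox: "integrable lborel (indicator (cbox a b :: 'a::euclidean_space set) :: _ \<Rightarrow> real)"
  by (intro integrable_real_indicator emeasure_lborel_cbox_finite) simp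

section \<open>Multiplication by tent functions\<close>

text \<open>The product over the coordinates of one-dimensional triangle functions of half-width \<open>R\<close>.\<close>

definition tent :: "real \<Rightarrow> 'a::euclidean_space \<Rightarrow> real" where
  "tent R u = (\<Prod>b\<in>Basis. max 0 (1 - \<bar>u \<bullet> b\<bar> / R))"

abbreviation cube :: "real \<Rightarrow> 'a::euclidean_space set" where
  "cube R \<equiv> cbox 0 (R *\<^sub>R One)"

lemma tent_nonneg: "0 \<le> tent R u"
  by (auto simp: tent_def intro!: prod_nonneg)

lemma tent_le_1: "R > 0 \<Longrightarrow> tent R u \<le> 1"
  by (auto simp: tent_def intro!: prod_le_1)

lemma continuous_on_tent [continuous_intros]: "continuous_on A (tent R)"
  unfolding tent_def[abs_def] divide_inverse by (intro continuous_intros)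

lemma tent_eq_0:
  assumes "R > 0" "u \<notin> cbox (- (R *\<^sub>R One)) (R *\<^sub>R One)"
  shows "tent R u = 0"
proof -
  obtain b where b: "b \<in> Basis" "\<not> (- R \<le> u \<bullet> b \<and> u \<bullet> b \<le> R)"
    using assms(2) by (auto simp: mem_box)
  then have "max 0 (1 - \<bar>u \<bullet> b\<bar> / R) = 0"
    using assms(1) by (auto simp: field_simps max_def)
  then show ?thesis using b(1) by (auto simp: tent_def)
qed

lemma tent_tendsto_1: "(\<lambda>n. tent (real (Suc n)) u) \<longlonglongrightarrow> 1"
proof -
  have "(\<lambda>n. tent (real (Suc n)) u) \<longlonglongrightarrow> (\<Prod>b\<in>(Basis::'a set). max 0 (1 - 0))"
    unfolding tent_def
  proof (intro tendsto_intros)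
    show "(\<lambda>n. \<bar>u \<bullet> b\<bar> / real (Suc n)) \<longlonglongrightarrow> 0" for b
      using LIMSEQ_inverse_real_of_nat by (auto simp: divide_inverse intro: tendsto_mult_right_zero)
  qed
  then show ?thesis by simp
qed

text \<open>The tent function is the normalised autocorrelation of the indicator of a cube.\<close>

lemma integral_cube_overlap:
  fixes u :: "'a::euclidean_space"
  assumes R: "R > 0"
  shows "(LINT t|lborel. indicator (cube R) t * indicator (cube R) (t - u)) = R ^ DIM('a) * tent R u"
proof -
  define l :: 'a where "l = (\<Sum>b\<in>Basis. max 0 (u \<bullet> b) *\<^sub>R b)"
  define r :: 'a where "r = (\<Sum>b\<in>Basis. min R (R + u \<bullet> b) *\<^sub>R b)"
  have lb: "l \<bullet> b = max 0 (u \<bullet> b)" and rb: "r \<bullet> b = min R (R + u \<bullet> b)" if "b \<in> Basis" for b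
    using that by (simp_all add: l_def r_def)
  have "indicator (cube R) t * indicator (cube R) (t - u) = (indicator (cbox l r) t :: real)" for t
  proof -
    have "t \<in> cube R \<and> t - u \<in> cube R \<longleftrightarrow> t \<in> cbox l r"
      by (auto simp: mem_box lb rb inner_diff_left)
    then show ?thesis by (auto simp: indicator_def)
  qed
  then have "(LINT t|lborel. indicator (cube R) t * indicator (cube R) (t - u)) = measure lborel (cbox l r)"
    by simp
  also have "\<dots> = R ^ DIM('a) * tent R u"
  proof (cases "\<forall>b\<in>Basis. l \<bullet> b \<le> r \<bullet> b")
    case True
    then have "measure lborel (cbox l r) = (\<Prod>b\<in>Basis. (r - l) \<bullet> b)"
      by (simp add: measure_lborel_cbox_eq)
    also have "\<dots> = (\<Prod>b\<in>Basis. R * max 0 (1 - \<bar>u \<bullet> b\<bar> / R))"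
    proof (rule prod.cong[OF refl])
      fix b :: 'a assume b: "b \<in> Basis"
      with True have le: "l \<bullet> b \<le> r \<bullet> b" by auto
      then have "\<bar>u \<bullet> b\<bar> \<le> R" using lb[OF b] rb[OF b] by linarith
      then have "R * max 0 (1 - \<bar>u \<bullet> b\<bar> / R) = R - \<bar>u \<bullet> b\<bar>"
        using R by (simp add: max_def field_simps)
      then show "(r - l) \<bullet> b = R * max 0 (1 - \<bar>u \<bullet> b\<bar> / R)"
        using lb[OF b] rb[OF b] by (simp add: inner_diff_left)
    qed
    also have "\<dots> = R ^ DIM('a) * tent R u" by (simp add: tent_def prod.distrib)
    finally show ?thesis .
  next
    case False
    then obtain b where b: "b \<in> Basis" "l \<bullet> b > r \<bullet> b" by force
    then have "\<bar>u \<bullet> b\<bar> > R" using lb[OF b(1)] rb[OF b(1)] by linarith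
    then have "max 0 (1 - \<bar>u \<bullet> b\<bar> / R) = 0" using R by (simp add: max_def field_simps)
    then have "tent R u = 0" using b(1) by (auto simp: tent_def)
    then show ?thesis using False unfolding measure_lborel_cbox_eq by auto
  qed
  finally show ?thesis .
qed

lemma positive_definite_mult_tent:
  assumes f: "positive_definite f" and R: "R > 0"
  shows "positive_definite (\<lambda>x. f x * tent R x)"
proof -
  define h :: "'a \<Rightarrow> 'a \<Rightarrow> complex" where "h t x = indicator (cube R) (t - x)" for t x
  have int_eq: "(LINT t|lborel. indicator (cube R) (t - x) * indicator (cube R) (t - y) :: real)
      = R ^ DIM('a) * tent R (x - y)" for x y :: 'a
  proof -
    have "(LINT t|lborel. indicator (cube R) (t - x) * indicator (cube R) (t - y) :: real)
      = (LINT t|distr lborel borel ((+) y). indicator (cube R) (t - x) * indicator (cube R) (t - y))"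
      by (simp add: lborel_distr_plus)
    also have "\<dots> = (LINT t|lborel. indicator (cube R) t * indicator (cube R) (t - (x - y)))"
      by (subst integral_distr) (auto simp: algebra_simps intro!: borel_measurable_times)
    finally show ?thesis by (simp only: integral_cube_overlap[OF R])
  qed
  have int: "integrable lborel (\<lambda>t. indicator (cube R) (t - x) * indicator (cube R) (t - y) :: real)"
    for x y :: 'a
  proof -
    have *: "(\<lambda>t. indicator (cube R) (t - x) * indicator (cube R) (t - y) :: real) =
        indicator (cbox x (x + R *\<^sub>R One) \<inter> cbox y (y + R *\<^sub>R One))"
      by (auto simp: fun_eq_iff indicator_def mem_box inner_diff_left inner_add_left algebra_simps)
    show ?thesis unfolding * Int_interval by (rule integrable_indicator_cbox)
  qed
  have hh: "h t x * cnj (h t y) * complex_of_real (f (x - y)) =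
     complex_of_real (f (x - y) * (indicator (cube R) (t - x) * indicator (cube R) (t - y)))" for t x y
    by (auto simp: h_def indicator_def)
  have "psd_kernel (\<lambda>x y. LINT t|lborel. h t x * cnj (h t y) * complex_of_real (f (x - y)))"
  proof (rule psd_kernel_integral)
    show "psd_kernel (\<lambda>x y. h t x * cnj (h t y) * complex_of_real (f (x - y)))" for t
      using f by (intro psd_kernel_mult_rank_one) (simp add: positive_definite_iff_psd_kernel)
    show "integrable lborel (\<lambda>t. h t x * cnj (h t y) * complex_of_real (f (x - y)))" for x y
      unfolding hh by (intro integrable_of_real integrable_mult_right int)
  qed
  then have "positive_definite (\<lambda>x. R ^ DIM('a) * (f x * tent R x))"
    unfolding positive_definite_iff_psd_kernel hh integral_complex_of_real
    by (simp add: int_eq mult_ac)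
  then have "positive_definite (\<lambda>x. (1 / R ^ DIM('a)) * (R ^ DIM('a) * (f x * tent R x)))"
    using R by (intro positive_definite_scale[of "\<lambda>x. R ^ DIM('a) * (f x * tent R x)"]) simp_all
  moreover have "(\<lambda>x. (1 / R ^ DIM('a)) * (R ^ DIM('a) * (f x * tent R x))) = (\<lambda>x. f x * tent R x)"
    using R by auto
  ultimately show ?thesis by simp
qed

section \<open>Nonnegativity of the Fourier transform\<close>

lemma integrable_fourier_integrand:
  fixes f :: "'a::euclidean_space \<Rightarrow> real"
  assumes "integrable lborel f"
  shows "integrable lborel (\<lambda>x. complex_of_real (f x) * exp (- (\<i> * complex_of_real (s \<bullet> x))))"
proof (rule Bochner_Integration.integrable_bound[OF assms])
  have [measurable]: "f \<in> borel_measurable borel" using assms by auto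
  show "(\<lambda>x. complex_of_real (f x) * exp (- (\<i> * complex_of_real (s \<bullet> x)))) \<in> borel_measurable lborel"
    by measurable
qed (simp add: norm_mult)

text \<open>
  Integrating the kernel \<open>f (x - y)\<close> against the character \<open>exp (-\<i> s x)\<close> on a cube of side \<open>R\<close>
  gives, up to the factor \<open>R\<^sup>d\<close>, the transform of \<open>f\<close> times the tent of half-width \<open>R\<close>. It is
  nonnegative, and \<open>R\<close> can be sent to infinity.
\<close>

lemma fourier_nonneg:
  fixes f :: "'a::euclidean_space \<Rightarrow> real"
  assumes cont: "continuous_on UNIV f" and pd: "positive_definite f" and int: "integrable lborel f"
  shows "fourier f s \<in> \<real>\<^sub>\<ge>\<^sub>0"
proof -
  define E where "E u = exp (- (\<i> * complex_of_real (s \<bullet> u)))" for u :: 'a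
  have E_cis: "E u = cis (- (s \<bullet> u))" for u by (simp add: E_def cis_conv_exp)
  have E_diff: "E x * cnj (E y) = E (x - y)" for x y
    by (simp add: E_cis cis_cnj cis_mult inner_diff_right)
  have E_norm: "norm (E u) = 1" for u by (simp add: E_def)
  have fm[measurable]: "f \<in> borel_measurable borel" using int by auto
  have Em[measurable]: "E \<in> borel_measurable borel" unfolding E_def[abs_def] by measurable
  have fE: "integrable lborel (\<lambda>x. complex_of_real (f x) * E x)"
    using integrable_fourier_integrand[OF int] by (simp add: E_def)
  have "(LINT u|lborel. complex_of_real (f u) * E u * of_real (tent R u)) \<in> \<real>\<^sub>\<ge>\<^sub>0" if R: "R > 0" for R
  proof -
    define h where "h x = indicator (cube R) x *\<^sub>R E x" for x
    have hint: "integrable lborel h"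
    proof (rule Bochner_Integration.integrable_bound)
      show "integrable lborel (indicator (cube R) :: 'a \<Rightarrow> real)"
        by (rule integrable_indicator_cbox)
    qed (auto simp: h_def[abs_def] E_norm)
    have "(LINT x|lborel. LINT y|lborel. h x * cnj (h y) * complex_of_real (f (x - y))) \<in> \<real>\<^sub>\<ge>\<^sub>0"
    proof (rule psd_kernel_double_integral[OF _ _ _ hint])
      show "psd_kernel (\<lambda>x y. complex_of_real (f (x - y)))"
        using pd by (simp add: positive_definite_iff_psd_kernel)
      show "continuous_on UNIV (\<lambda>(x, y). complex_of_real (f (x - y)))"
        unfolding case_prod_unfold
        by (intro continuous_intros continuous_on_compose2[OF cont]) auto
      show "norm (complex_of_real (f (x - y))) \<le> f 0" for x y
        using positive_definite_abs_le[OF pd] by simp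
    qed
    \<comment> \<open>substitute \<open>y = x - u\<close>\<close>
    also have "(\<lambda>x. LINT y|lborel. h x * cnj (h y) * complex_of_real (f (x - y))) =
        (\<lambda>x. LINT u|lborel. (complex_of_real (f u) * E u) * of_real (indicator (cube R) x * indicator (cube R) (x - u)))"
    proof
      fix x
      have "(LINT y|lborel. h x * cnj (h y) * complex_of_real (f (x - y))) =
         (LINT u|lborel. h x * cnj (h (x - u)) * complex_of_real (f (x - (x - u))))"
        by (rule lborel_integral_diff[symmetric]) (simp add: h_def)
      also have "\<dots> = (LINT u|lborel. (complex_of_real (f u) * E u) * of_real (indicator (cube R) x * indicator (cube R) (x - u)))"
      proof (rule Bochner_Integration.integral_cong[OF refl])
        fix u
        have "E x * cnj (E (x - u)) = E u" using E_diff[of x "x - u"] by simp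
        then show "h x * cnj (h (x - u)) * complex_of_real (f (x - (x - u))) =
            (complex_of_real (f u) * E u) * of_real (indicator (cube R) x * indicator (cube R) (x - u))"
          by (simp add: h_def indicator_def del: mem_box)
      qed
      finally show "(LINT y|lborel. h x * cnj (h y) * complex_of_real (f (x - y))) = \<dots>" .
    qed
    also have "(LINT x|lborel. LINT u|lborel. (complex_of_real (f u) * E u) * of_real (indicator (cube R) x * indicator (cube R) (x - u)))
      = (LINT u|lborel. LINT x|lborel. (complex_of_real (f u) * E u) * of_real (indicator (cube R) x * indicator (cube R) (x - u)))"
    proof (rule lborel_pair.Fubini_integral)
      have "integrable (lborel \<Otimes>\<^sub>M lborel) (\<lambda>p. f (fst p) * indicator (cube R) (snd p))"
      proof (rule lborel_pair.Fubini_integrable)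
        show "integrable lborel (\<lambda>x. LINT y|lborel. norm (f (fst (x, y)) * indicator (cube R) (snd (x, y))))"
          using int by (simp add: abs_mult)
        show "AE x in lborel. integrable lborel (\<lambda>y. f (fst (x, y)) * indicator (cube R) (snd (x, y)))"
          by (simp add: integrable_indicator_cbox)
      qed measurable
      then show "integrable (lborel \<Otimes>\<^sub>M lborel) (\<lambda>(u, x). (complex_of_real (f u) * E u) * of_real (indicator (cube R) x * indicator (cube R) (x - u)))"
      proof (rule Bochner_Integration.integrable_bound)
        show "AE p in lborel \<Otimes>\<^sub>M lborel. norm (case p of (u, x) \<Rightarrow>
            (complex_of_real (f u) * E u) * of_real (indicator (cube R) x * indicator (cube R) (x - u)))
          \<le> norm (f (fst p) * indicator (cube R) (snd p))"
          by (rule AE_I2) (simp add: split_beta norm_mult E_norm abs_mult indicator_def)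
      qed measurable
    qed
    also have "\<dots> = (LINT u|lborel. (complex_of_real (f u) * E u) * of_real (R ^ DIM('a) * tent R u))"
      by (simp only: integral_mult_right_zero integral_complex_of_real integral_cube_overlap[OF R])
    also have "\<dots> = complex_of_real (R ^ DIM('a)) * (LINT u|lborel. (complex_of_real (f u) * E u) * of_real (tent R u))"
      by (subst integral_mult_right_zero[symmetric]) (simp add: mult_ac)
    finally have *: "complex_of_real (R ^ DIM('a)) * (LINT u|lborel. (complex_of_real (f u) * E u) * of_real (tent R u)) \<in> \<real>\<^sub>\<ge>\<^sub>0" .
    have "complex_of_real (1 / R ^ DIM('a)) * (complex_of_real (R ^ DIM('a)) * (LINT u|lborel. (complex_of_real (f u) * E u) * of_real (tent R u))) \<in> \<real>\<^sub>\<ge>\<^sub>0"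
      using R by (intro nonneg_Reals_mult_I[OF _ *]) auto
    then show ?thesis using R by simp
  qed
  then have "(LINT u|lborel. complex_of_real (f u) * E u * of_real (tent (real (Suc n)) u)) \<in> \<real>\<^sub>\<ge>\<^sub>0" for n
    by simp
  moreover have "(\<lambda>n. LINT u|lborel. complex_of_real (f u) * E u * of_real (tent (real (Suc n)) u))
     \<longlonglongrightarrow> (LINT u|lborel. complex_of_real (f u) * E u)"
  proof (rule integral_dominated_convergence[where w="\<lambda>u. \<bar>f u\<bar>"])
    have [measurable]: "(tent r :: 'a \<Rightarrow> real) \<in> borel_measurable borel" for r
      by (intro borel_measurable_continuous_onI continuous_intros)
    show "(\<lambda>u. complex_of_real (f u) * E u * of_real (tent (real (Suc n)) u)) \<in> borel_measurable lborel" for n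
      by measurable
    have "\<bar>f u\<bar> * tent (real (Suc n)) u \<le> \<bar>f u\<bar> * 1" for u n
      by (intro mult_left_mono tent_le_1) auto
    then show "AE u in lborel. norm (complex_of_real (f u) * E u * of_real (tent (real (Suc n)) u)) \<le> \<bar>f u\<bar>" for n
      by (simp add: norm_mult E_norm tent_nonneg)
    have "(\<lambda>n. complex_of_real (f u) * E u * of_real (tent (real (Suc n)) u)) \<longlonglongrightarrow> complex_of_real (f u) * E u * of_real 1" for u
      by (intro tendsto_intros tent_tendsto_1)
    then show "AE u in lborel. (\<lambda>n. complex_of_real (f u) * E u * of_real (tent (real (Suc n)) u)) \<longlonglongrightarrow> complex_of_real (f u) * E u"
      by simp
  qed (use fE int in auto)
  ultimately have "(LINT u|lborel. complex_of_real (f u) * E u) \<in> \<real>\<^sub>\<ge>\<^sub>0"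
    by (rule closed_sequentially[OF closed_nonneg_Reals_complex])
  then show ?thesis by (simp add: fourier_def E_def)
qed

lemma fourier_0: "fourier f 0 = complex_of_real (LINT x|lborel. f x)"
  by (simp add: fourier_def)

lemma positive_definite_integral_nonneg:
  fixes f :: "'a::euclidean_space \<Rightarrow> real"
  assumes "continuous_on UNIV f" "positive_definite f" "integrable lborel f"
  shows "(LINT x|lborel. f x) \<ge> 0"
  using fourier_nonneg[OF assms, of 0] by (simp add: fourier_0)

section \<open>Truncation of bandlimited functions\<close>

lemma bandlimited_le_delsarte:
  fixes B :: "'a::euclidean_space set"
  assumes B: "bounded B"
  shows "bandlimited_delsarte_const B \<le> delsarte_const B"
  unfolding bandlimited_delsarte_const_def
proof (rule SUP_least)
  fix f assume "f \<in> bandlimited_delsarte_class B"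
  then have cont: "continuous_on UNIV f" and int: "integrable lborel f" and pd: "positive_definite f"
    and f0: "f 0 = 1" and supp: "supp (pos_part f) \<subseteq> B"
    by (auto simp: bandlimited_delsarte_class_def)
  have [measurable]: "f \<in> borel_measurable borel" using int by auto
  define F where "F n = (\<lambda>x. f x * tent (real (Suc n)) x)" for n
  have tent0: "tent r (0::'a) = 1" for r by (simp add: tent_def)
  have "F n \<in> delsarte_class B" for n
  proof -
    have sub: "{x. pos_part (F n) x \<noteq> 0} \<subseteq> {x. pos_part f x \<noteq> 0}"
    proof clarify
      fix x assume "pos_part (F n) x \<noteq> 0" "pos_part f x = 0"
      then have "f x \<le> 0" "f x * tent (real (Suc n)) x > 0"
        by (auto simp: pos_part_def F_def max_def split: if_splits)
      then show False
        using mult_nonpos_nonneg[of "f x", OF _ tent_nonneg[of "real (Suc n)" x]] by linarith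
    qed
    then have sub': "supp (pos_part (F n)) \<subseteq> supp (pos_part f)"
      by (auto simp: supp_def intro: closure_mono[THEN subsetD])
    have cpt: "compact (supp (pos_part (F n)))"
      using sub' supp bounded_subset[OF B] by (auto simp: supp_def compact_eq_bounded_closed)
    let ?C = "cbox (- (real (Suc n) *\<^sub>R One)) (real (Suc n) *\<^sub>R One) :: 'a set"
    have "{x. neg_part (F n) x \<noteq> 0} \<subseteq> ?C"
    proof (rule subsetI, rule ccontr)
      fix x assume "x \<in> {x. neg_part (F n) x \<noteq> 0}" "x \<notin> ?C"
      moreover from this have "tent (real (Suc n)) x = 0" by (intro tent_eq_0) simp_all
      ultimately show False by (simp add: neg_part_def F_def)
    qed
    then have "supp (neg_part (F n)) \<subseteq> ?C"
      unfolding supp_def by (intro closure_minimal) auto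
    then have "compact (supp (neg_part (F n)))"
      by (metis supp_def bounded_cbox bounded_subset closed_closure compact_eq_bounded_closed)
    moreover have "continuous_on UNIV (F n)"
      unfolding F_def by (intro continuous_intros cont)
    moreover have "positive_definite (F n)"
      unfolding F_def by (intro positive_definite_mult_tent pd) auto
    ultimately show ?thesis
      using cpt sub' supp f0 by (auto simp: delsarte_class_def F_def tent0)
  qed
  then have le: "ereal (LINT x|lborel. F n x) \<le> delsarte_const B" for n
    unfolding delsarte_const_def by (intro SUP_upper)
  have "(\<lambda>n. LINT x|lborel. F n x) \<longlonglongrightarrow> (LINT x|lborel. f x)"
  proof (rule integral_dominated_convergence[where w="\<lambda>x. \<bar>f x\<bar>"])
    have [measurable]: "(tent r :: 'a \<Rightarrow> real) \<in> borel_measurable borel" for r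
      by (intro borel_measurable_continuous_onI continuous_intros)
    show "F n \<in> borel_measurable lborel" for n
      unfolding F_def by measurable
    have "\<bar>f u\<bar> * tent (real (Suc n)) u \<le> \<bar>f u\<bar> * 1" for u n
      by (intro mult_left_mono tent_le_1) auto
    then show "AE u in lborel. norm (F n u) \<le> \<bar>f u\<bar>" for n
      by (simp add: F_def abs_mult tent_nonneg)
    have "(\<lambda>n. F n u) \<longlonglongrightarrow> f u * 1" for u
      unfolding F_def by (intro tendsto_intros tent_tendsto_1)
    then show "AE u in lborel. (\<lambda>n. F n u) \<longlonglongrightarrow> f u"
      by simp
  qed (use int in auto)
  then have "(\<lambda>n. ereal (LINT x|lborel. F n x)) \<longlonglongrightarrow> ereal (LINT x|lborel. f x)"
    by (rule tendsto_ereal)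
  then show "ereal (LINT x|lborel. f x) \<le> delsarte_const B"
    by (rule LIMSEQ_le_const2) (use le in blast)
qed

section \<open>Transforms of compactly supported measures\<close>

text \<open>
  \<open>K\<close> is the Fourier transform of a finite positive Borel measure \<open>M\<close> carried by a ball. Using a
  measure rather than a density covers the cosine, whose spectrum is a pair of atoms, and makes
  products of such functions correspond to convolutions of measures.
\<close>

definition compact_spectrum :: "('a::euclidean_space \<Rightarrow> real) \<Rightarrow> bool" where
  "compact_spectrum K \<longleftrightarrow>
     (\<exists>M R. finite_measure M \<and> sets M = sets borel \<and> (AE s in M. norm s \<le> R) \<and>
        (\<forall>x. complex_of_real (K x) = (LINT s|M. cis (s \<bullet> x))))"

lemma borel_measurable_cis [measurable]: "cis \<in> borel_measurable borel"
  unfolding cis_conv_exp[abs_def] by measurable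

lemma compact_spectrum_1: "compact_spectrum (\<lambda>x::'a::euclidean_space. 1)"
  unfolding compact_spectrum_def
proof (intro exI conjI allI)
  show "finite_measure (return borel (0::'a))"
    by (intro prob_space.finite_measure prob_space_return) simp
  show "AE s in return borel (0::'a). norm s \<le> 0"
    by (subst AE_return) auto
  show "complex_of_real 1 = (LINT s|return borel 0. cis (s \<bullet> x))" for x :: 'a
    by (subst integral_return) auto
qed simp

lemma integrable_cis_inner:
  assumes "finite_measure M" "sets M = sets borel"
  shows "integrable M (\<lambda>s. cis (s \<bullet> (x::'a::euclidean_space)))"
proof -
  note assms(2)[measurable_cong]
  show ?thesis
    by (rule finite_measure.integrable_const_bound[OF assms(1), where B=1]) auto
qed

text \<open>The product has as its measure the distribution of the sum of the two frequencies.\<close>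

lemma compact_spectrum_mult:
  fixes K L :: "'a::euclidean_space \<Rightarrow> real"
  assumes "compact_spectrum K" "compact_spectrum L"
  shows "compact_spectrum (\<lambda>x. K x * L x)"
proof -
  obtain M R where M: "finite_measure M" and sM[measurable_cong]: "sets M = sets borel"
    and R: "AE s in M. norm s \<le> R"
    and K: "\<And>x. complex_of_real (K x) = (LINT s|M. cis (s \<bullet> x))"
    using assms(1) unfolding compact_spectrum_def by blast
  obtain M' R' where M': "finite_measure M'" and sM'[measurable_cong]: "sets M' = sets borel"
    and R': "AE s in M'. norm s \<le> R'"
    and L: "\<And>x. complex_of_real (L x) = (LINT s|M'. cis (s \<bullet> x))"
    using assms(2) unfolding compact_spectrum_def by blast
  interpret M: finite_measure M by fact
  interpret M': finite_measure M' by fact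
  interpret P: pair_sigma_finite M M' ..
  define N where "N = distr (M \<Otimes>\<^sub>M M') borel (\<lambda>p. fst p + snd p)"
  interpret MM: finite_measure "M \<Otimes>\<^sub>M M'"
    by (rule finite_measure_pair_measure[OF M' M])
  have N: "finite_measure N"
    unfolding N_def by (rule MM.finite_measure_distr) measurable
  show ?thesis
    unfolding compact_spectrum_def
  proof (intro exI conjI allI)
    show "finite_measure N" by (rule N)
    show "sets N = sets borel" by (simp add: N_def)
    have "AE p in M \<Otimes>\<^sub>M M'. norm (fst p + snd p) \<le> R + R'"
    proof (rule P.AE_pair_measure)
      show "AE x in M. AE y in M'. norm (fst (x, y) + snd (x, y)) \<le> R + R'"
        using R
      proof eventually_elim
        case (elim x)
        show ?case using R'
        proof eventually_elim
          case (elim y)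
          then show ?case using \<open>norm x \<le> R\<close> norm_triangle_ineq[of x y] by simp
        qed
      qed
    qed measurable
    then show "AE s in N. norm s \<le> R + R'"
      unfolding N_def by (subst AE_distr_iff) auto
    fix x
    have int: "integrable (M \<Otimes>\<^sub>M M') (\<lambda>(s, t). cis (s \<bullet> x) * cis (t \<bullet> x))"
      by (rule MM.integrable_const_bound[where B=1]) (auto simp: norm_mult)
    have "(LINT s|N. cis (s \<bullet> x)) = (LINT p|(M \<Otimes>\<^sub>M M'). cis ((fst p + snd p) \<bullet> x))"
      unfolding N_def by (subst integral_distr) auto
    also have "\<dots> = (LINT p|(M \<Otimes>\<^sub>M M'). (case p of (s, t) \<Rightarrow> cis (s \<bullet> x) * cis (t \<bullet> x)))"
      by (simp add: split_beta cis_mult inner_add_left)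
    also have "\<dots> = (LINT s|M. LINT t|M'. cis (s \<bullet> x) * cis (t \<bullet> x))"
      by (rule P.integral_fst'[OF int, symmetric, unfolded split_conv])
    also have "\<dots> = complex_of_real (K x * L x)"
      by (simp add: K L)
    finally show "complex_of_real (K x * L x) = (LINT s|N. cis (s \<bullet> x))" ..
  qed
qed

lemma compact_spectrum_power:
  "compact_spectrum K \<Longrightarrow> compact_spectrum (\<lambda>x. K x ^ n)"
  by (induction n) (auto intro: compact_spectrum_mult compact_spectrum_1)

lemma compact_spectrum_prod:
  "(\<And>i. i \<in> I \<Longrightarrow> compact_spectrum (K i)) \<Longrightarrow> compact_spectrum (\<lambda>x. \<Prod>i\<in>I. K i x)"
  by (induction I rule: infinite_finite_induct) (auto intro: compact_spectrum_mult compact_spectrum_1)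

lemma compact_spectrum_cos:
  "compact_spectrum (\<lambda>x::'a::euclidean_space. cos (a \<bullet> x))"
  unfolding compact_spectrum_def
proof (intro exI conjI allI)
  let ?P = "measure_pmf (pmf_of_set {a, - a})"
  let ?M = "distr ?P borel (\<lambda>s. s)"
  show "finite_measure ?M"
    by (intro finite_measure.finite_measure_distr prob_space.finite_measure prob_space_measure_pmf) simp
  show "sets ?M = sets borel" by simp
  show "AE s in ?M. norm s \<le> norm a"
    by (subst AE_distr_iff) (auto simp: AE_measure_pmf_iff set_pmf_of_set)
  fix x
  have "(LINT s|?M. cis (s \<bullet> x)) = (LINT s|?P. cis (s \<bullet> x))"
    by (subst integral_distr) auto
  also have "\<dots> = (\<Sum>s\<in>{a, - a}. pmf (pmf_of_set {a, - a}) s *\<^sub>R cis (s \<bullet> x))"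
    by (rule integral_measure_pmf) (auto simp: set_pmf_of_set)
  also have "\<dots> = complex_of_real (cos (a \<bullet> x))"
  proof (cases "a = 0")
    case False
    then have "a \<noteq> - a" by (metis add.inverse_unique add_eq_0_iff scaleR_2 scaleR_eq_0_iff zero_neq_numeral)
    then show ?thesis by (simp add: complex_eq_iff)
  qed (simp add: pmf_of_set)
  finally show "complex_of_real (cos (a \<bullet> x)) = (LINT s|?M. cis (s \<bullet> x))" ..
qed

lemma compact_spectrum_continuous:
  assumes "compact_spectrum K"
  shows "continuous_on UNIV K"
proof -
  obtain M R where M: "finite_measure M" and sM[measurable_cong]: "sets M = sets borel"
    and K: "\<And>x. complex_of_real (K x) = (LINT s|M. cis (s \<bullet> x))"
    using assms unfolding compact_spectrum_def by blast
  interpret finite_measure M by fact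
  have "isCont (\<lambda>x. LINT s|M. cis (s \<bullet> x)) x" for x
  proof (subst continuous_at_sequentially, intro allI impI)
    fix X assume X: "X \<longlonglongrightarrow> x"
    show "((\<lambda>x. LINT s|M. cis (s \<bullet> x)) \<circ> X) \<longlonglongrightarrow> (LINT s|M. cis (s \<bullet> x))"
      unfolding comp_def
    proof (rule integral_dominated_convergence[where w="\<lambda>_. 1"])
      have "(\<lambda>n. cis (s \<bullet> X n)) \<longlonglongrightarrow> cis (s \<bullet> x)" for s
        by (intro tendsto_intros X)
      then show "AE s in M. (\<lambda>n. cis (s \<bullet> X n)) \<longlonglongrightarrow> cis (s \<bullet> x)" by simp
    qed auto
  qed
  then have "continuous_on UNIV (\<lambda>x. complex_of_real (K x))"
    unfolding K by (simp add: continuous_on_eq_continuous_at)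
  then have "continuous_on UNIV (\<lambda>x. Re (complex_of_real (K x)))"
    by (rule continuous_on_Re)
  then show ?thesis by simp
qed

lemma psd_kernel_cis: "psd_kernel (\<lambda>x y. cis (s \<bullet> (x - y)))"
  using psd_kernel_mult_rank_one[OF psd_kernel_const, of "\<lambda>x. cis (s \<bullet> x)"]
  by (simp add: cis_cnj cis_mult inner_diff_right)

lemma compact_spectrum_positive_definite:
  assumes "compact_spectrum K"
  shows "positive_definite K"
proof -
  obtain M where M: "finite_measure M" and sM: "sets M = sets borel"
    and K: "\<And>x. complex_of_real (K x) = (LINT s|M. cis (s \<bullet> x))"
    using assms unfolding compact_spectrum_def by blast
  show ?thesis
    unfolding positive_definite_iff_psd_kernel K
    by (intro psd_kernel_integral psd_kernel_cis integrable_cis_inner M sM)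
qed

section \<open>Gaussian transforms\<close>

lemma
  fixes f :: "'a::euclidean_space \<Rightarrow> real \<Rightarrow> _::{real_normed_field,banach,second_countable_topology}"
  assumes int: "\<And>b. b \<in> Basis \<Longrightarrow> integrable lborel (f b)"
  shows integrable_lborel_prod: "integrable lborel (\<lambda>x::'a. \<Prod>b\<in>Basis. f b (x \<bullet> b))"
    and integral_lborel_prod: "(LINT x|lborel. (\<Prod>b\<in>Basis. f b ((x::'a) \<bullet> b))) = (\<Prod>b\<in>Basis. (LINT x|lborel. f b x))"
proof -
  interpret product_sigma_finite "\<lambda>_::'a. lborel :: real measure" ..
  have [measurable]: "f b \<in> borel_measurable borel" if "b \<in> Basis" for b
    using int[OF that] by auto
  have comb: "(\<Sum>b\<in>Basis. y b *\<^sub>R b) \<bullet> b = y b" if "b \<in> Basis" for y :: "'a \<Rightarrow> real" and b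
    using that by simp
  have [measurable]: "(\<lambda>x::'a. \<Prod>b\<in>Basis. f b (x \<bullet> b)) \<in> borel_measurable borel"
    by measurable
  have L: "(lborel :: 'a measure) = distr (\<Pi>\<^sub>M b\<in>Basis. lborel) borel (\<lambda>y. \<Sum>b\<in>Basis. y b *\<^sub>R b)"
    by (rule lborel_eq)
  show "integrable lborel (\<lambda>x::'a. \<Prod>b\<in>Basis. f b (x \<bullet> b))"
    unfolding L
    by (subst integrable_distr_eq) (simp_all add: comb int product_integrable_prod cong: prod.cong)
  show "(LINT x|lborel. (\<Prod>b\<in>Basis. f b ((x::'a) \<bullet> b))) = (\<Prod>b\<in>Basis. (LINT x|lborel. f b x))"
    unfolding L
    by (subst integral_distr) (simp_all add: comb int product_integral_prod cong: prod.cong)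
qed

lemma
  fixes \<sigma> \<xi> :: real
  assumes \<sigma>: "\<sigma> > 0"
  shows integrable_gauss_cis: "integrable lborel (\<lambda>x. complex_of_real (exp (- (x / \<sigma>)\<^sup>2 / 2)) * cis (\<xi> * x))"
    and integral_gauss_cis: "(LINT x|lborel. complex_of_real (exp (- (x / \<sigma>)\<^sup>2 / 2)) * cis (\<xi> * x)) =
      complex_of_real (\<sigma> * sqrt (2 * pi) * exp (- (\<sigma> * \<xi>)\<^sup>2 / 2))"
proof -
  let ?g = "\<lambda>x. complex_of_real (exp (- (x / \<sigma>)\<^sup>2 / 2)) * cis (\<xi> * x)"
  have eq: "?g (0 + \<sigma> * y) = complex_of_real (sqrt (2 * pi)) * (std_normal_density y *\<^sub>R iexp ((\<sigma> * \<xi>) * y))" for y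
    using \<sigma> by (simp add: std_normal_density_def cis_conv_exp scaleR_conv_of_real mult_ac real_sqrt_mult)
  have int: "integrable lborel (\<lambda>y. std_normal_density y *\<^sub>R iexp ((\<sigma> * \<xi>) * y))"
  proof (rule Bochner_Integration.integrable_bound)
    show "integrable lborel std_normal_density" by simp
  qed auto
  have "integrable lborel (\<lambda>y. ?g (0 + \<sigma> * y))"
    unfolding eq using int by (rule integrable_mult_right)
  then show "integrable lborel ?g"
    using \<sigma> lborel_integrable_real_affine_iff[of \<sigma> ?g 0] by simp
  have "(LINT y|lborel. std_normal_density y *\<^sub>R iexp ((\<sigma> * \<xi>) * y)) = char std_normal_distribution (\<sigma> * \<xi>)"
    unfolding char_def by (subst integral_density) auto
  also have "\<dots> = complex_of_real (exp (- (\<sigma> * \<xi>)\<^sup>2 / 2))"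
    by (simp add: char_std_normal_distribution)
  finally have "(LINT y|lborel. ?g (0 + \<sigma> * y)) =
      complex_of_real (sqrt (2 * pi)) * complex_of_real (exp (- (\<sigma> * \<xi>)\<^sup>2 / 2))"
    unfolding eq by (simp only: integral_mult_right_zero)
  moreover have "integral\<^sup>L lborel ?g = \<bar>\<sigma>\<bar> *\<^sub>R (LINT y|lborel. ?g (0 + \<sigma> * y))"
    using \<sigma> by (intro lborel_integral_real_affine) auto
  ultimately show "integral\<^sup>L lborel ?g = complex_of_real (\<sigma> * sqrt (2 * pi) * exp (- (\<sigma> * \<xi>)\<^sup>2 / 2))"
    using \<sigma> by (simp add: scaleR_conv_of_real)
qed

lemma
  fixes \<xi> :: "'a::euclidean_space"
  assumes \<sigma>: "\<sigma> > 0"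
  shows integrable_gauss_cis_inner: "integrable lborel (\<lambda>x. complex_of_real (exp (- (norm x / \<sigma>)\<^sup>2 / 2)) * cis (\<xi> \<bullet> x))"
    and integral_gauss_cis_inner: "(LINT x|lborel. complex_of_real (exp (- (norm x / \<sigma>)\<^sup>2 / 2)) * cis (\<xi> \<bullet> x)) =
      complex_of_real ((\<sigma> * sqrt (2 * pi)) ^ DIM('a) * exp (- (\<sigma> * norm \<xi>)\<^sup>2 / 2))"
proof -
  have ex: "exp (\<Sum>b\<in>Basis. h b) = (\<Prod>b\<in>Basis. exp (h b))" for h :: "'a \<Rightarrow> real"
    by (simp add: exp_sum)
  have nrm: "(c * norm x)\<^sup>2 = (\<Sum>b\<in>Basis. (c * (x \<bullet> b))\<^sup>2)" for x :: 'a and c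
    by (simp add: power_mult_distrib sum_distrib_left[symmetric] power2_norm_eq_inner
        euclidean_inner[of x x] power2_eq_square[symmetric])
  have gs: "exp (- (c * norm x)\<^sup>2 / 2) = (\<Prod>b\<in>Basis. exp (- (c * (x \<bullet> b))\<^sup>2 / 2))" for x :: 'a and c
    unfolding nrm ex[symmetric] by (simp add: sum_negf sum_divide_distrib)
  have cs: "cis (\<xi> \<bullet> x) = (\<Prod>b\<in>Basis. cis ((\<xi> \<bullet> b) * (x \<bullet> b)))" for x
    unfolding euclidean_inner[of \<xi> x] by (simp add: cis_conv_exp sum_distrib_left exp_sum)
  have eq: "complex_of_real (exp (- (norm x / \<sigma>)\<^sup>2 / 2)) * cis (\<xi> \<bullet> x) =
     (\<Prod>b\<in>Basis. complex_of_real (exp (- ((x \<bullet> b) / \<sigma>)\<^sup>2 / 2)) * cis ((\<xi> \<bullet> b) * (x \<bullet> b)))" for x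
    using gs[of "1 / \<sigma>" x] by (simp add: cs prod.distrib)
  show "integrable lborel (\<lambda>x. complex_of_real (exp (- (norm x / \<sigma>)\<^sup>2 / 2)) * cis (\<xi> \<bullet> x))"
    unfolding eq by (intro integrable_lborel_prod integrable_gauss_cis \<sigma>)
  have "(LINT x|lborel. complex_of_real (exp (- (norm x / \<sigma>)\<^sup>2 / 2)) * cis (\<xi> \<bullet> x)) =
     (\<Prod>b\<in>(Basis::'a set). complex_of_real (\<sigma> * sqrt (2 * pi) * exp (- (\<sigma> * (\<xi> \<bullet> b))\<^sup>2 / 2)))"
    unfolding eq
    by (subst integral_lborel_prod) (simp_all only: integrable_gauss_cis[OF \<sigma>] integral_gauss_cis[OF \<sigma>])
  also have "\<dots> = complex_of_real ((\<sigma> * sqrt (2 * pi)) ^ DIM('a) * exp (- (\<sigma> * norm \<xi>)\<^sup>2 / 2))"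
    unfolding gs by (simp add: prod.distrib)
  finally show "(LINT x|lborel. complex_of_real (exp (- (norm x / \<sigma>)\<^sup>2 / 2)) * cis (\<xi> \<bullet> x)) =
      complex_of_real ((\<sigma> * sqrt (2 * pi)) ^ DIM('a) * exp (- (\<sigma> * norm \<xi>)\<^sup>2 / 2))" .
qed

section \<open>Vanishing of the transform outside the spectrum\<close>

lemma gauss_weight_tendsto_1:
  "(\<lambda>n. exp (- (norm (x::'a::real_normed_vector) / real (Suc n))\<^sup>2 / 2)) \<longlonglongrightarrow> 1"
proof -
  have "(\<lambda>n. norm x / real (Suc n)) \<longlonglongrightarrow> 0"
    using LIMSEQ_inverse_real_of_nat by (auto simp: divide_inverse intro: tendsto_mult_right_zero)
  then have "(\<lambda>n. exp (- (norm x / real (Suc n))\<^sup>2 / 2)) \<longlonglongrightarrow> exp (- 0\<^sup>2 / 2)"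
    by (intro tendsto_intros) auto
  then show ?thesis by simp
qed

lemma poly_gauss_tendsto_0:
  assumes "\<rho> > 0"
  shows "(\<lambda>n. C * ((real (Suc n) * sqrt (2 * pi)) ^ d * exp (- (real (Suc n) * \<rho>)\<^sup>2 / 2))) \<longlonglongrightarrow> 0"
proof -
  have "((\<lambda>t. t ^ d / exp t) \<longlongrightarrow> (0::real)) at_top"
    by (rule tendsto_power_div_exp_0)
  moreover have "filterlim (\<lambda>n. (real (Suc n) * \<rho>)\<^sup>2 / 2) at_top sequentially"
    using assms by real_asymp
  ultimately have lim: "(\<lambda>n. ((real (Suc n) * \<rho>)\<^sup>2 / 2) ^ d / exp ((real (Suc n) * \<rho>)\<^sup>2 / 2)) \<longlonglongrightarrow> 0"
    by (rule filterlim_compose)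
  show ?thesis
  proof (rule Lim_null_comparison)
    show "(\<lambda>n. (\<bar>C\<bar> * (sqrt (2 * pi) * 2 / \<rho>\<^sup>2) ^ d) * (((real (Suc n) * \<rho>)\<^sup>2 / 2) ^ d / exp ((real (Suc n) * \<rho>)\<^sup>2 / 2))) \<longlonglongrightarrow> 0"
      using lim by (rule tendsto_mult_right_zero)
    show "\<forall>\<^sub>F n in sequentially. norm (C * ((real (Suc n) * sqrt (2 * pi)) ^ d * exp (- (real (Suc n) * \<rho>)\<^sup>2 / 2)))
        \<le> (\<bar>C\<bar> * (sqrt (2 * pi) * 2 / \<rho>\<^sup>2) ^ d) * (((real (Suc n) * \<rho>)\<^sup>2 / 2) ^ d / exp ((real (Suc n) * \<rho>)\<^sup>2 / 2))"
    proof (intro always_eventually allI)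
      fix n
      let ?N = "real (Suc n)"
      have "(sqrt (2 * pi) * 2 / \<rho>\<^sup>2) * ((?N * \<rho>)\<^sup>2 / 2) = sqrt (2 * pi) * ?N\<^sup>2"
        using assms by (simp add: power_mult_distrib field_simps del: of_nat_Suc)
      then have eq: "(sqrt (2 * pi) * 2 / \<rho>\<^sup>2) ^ d * ((?N * \<rho>)\<^sup>2 / 2) ^ d = (sqrt (2 * pi) * ?N\<^sup>2) ^ d"
        by (metis power_mult_distrib)
      have "?N * 1 \<le> ?N * ?N" by (intro mult_left_mono) auto
      then have "?N * sqrt (2 * pi) \<le> sqrt (2 * pi) * ?N\<^sup>2"
        unfolding power2_eq_square by (simp add: mult.commute del: of_nat_Suc)
      then have "(?N * sqrt (2 * pi)) ^ d \<le> (sqrt (2 * pi) * ?N\<^sup>2) ^ d"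
        by (intro power_mono) auto
      then have "\<bar>C\<bar> * ((?N * sqrt (2 * pi)) ^ d * exp (- (?N * \<rho>)\<^sup>2 / 2)) \<le>
          \<bar>C\<bar> * ((sqrt (2 * pi) * ?N\<^sup>2) ^ d * exp (- (?N * \<rho>)\<^sup>2 / 2))"
        by (intro mult_left_mono mult_right_mono) auto
      also have "\<dots> = (\<bar>C\<bar> * (sqrt (2 * pi) * 2 / \<rho>\<^sup>2) ^ d) * (((?N * \<rho>)\<^sup>2 / 2) ^ d / exp ((?N * \<rho>)\<^sup>2 / 2))"
        unfolding eq[symmetric] by (simp add: exp_minus field_simps del: of_nat_Suc)
      finally show "norm (C * ((?N * sqrt (2 * pi)) ^ d * exp (- (?N * \<rho>)\<^sup>2 / 2)))
        \<le> (\<bar>C\<bar> * (sqrt (2 * pi) * 2 / \<rho>\<^sup>2) ^ d) * (((?N * \<rho>)\<^sup>2 / 2) ^ d / exp ((?N * \<rho>)\<^sup>2 / 2))"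
        by (simp add: abs_mult del: of_nat_Suc)
    qed
  qed
qed

lemma fourier_eq_cis: "fourier f s = (LINT x|lborel. complex_of_real (f x) * cis (- (s \<bullet> x)))"
  by (simp add: fourier_def cis_conv_exp)

text \<open>
  The easy half of Fourier inversion. With the Gaussian weight \<open>exp (- \<bar>x\<bar>\<^sup>2 / (2 n\<^sup>2))\<close> inserted, the
  transform of \<open>K\<close> at \<open>s\<close> becomes an integral over the spectrum of Gaussians of width \<open>1/n\<close> centred
  at \<open>s\<close>; these tend to \<open>0\<close> uniformly on the spectrum when \<open>s\<close> has positive distance \<open>\<rho>\<close> from
  its ball.
\<close>

lemma fourier_compact_spectrum_vanishes:
  fixes K :: "'a::euclidean_space \<Rightarrow> real"
  assumes K: "compact_spectrum K" and int: "integrable lborel K"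
  obtains R where "\<And>s. norm s > R \<Longrightarrow> fourier K s = 0"
proof -
  obtain M R where M: "finite_measure M" and sM[measurable_cong]: "sets M = sets borel"
    and R: "AE s in M. norm s \<le> R"
    and K: "\<And>x. complex_of_real (K x) = (LINT s|M. cis (s \<bullet> x))"
    using assms(1) unfolding compact_spectrum_def by blast
  interpret M: finite_measure M by fact
  interpret P: pair_sigma_finite M "lborel :: 'a measure" ..
  have [measurable]: "K \<in> borel_measurable borel" using int by auto
  have "fourier K s = 0" if s: "norm s > R" for s
  proof -
    define \<rho> where "\<rho> = norm s - R"
    have \<rho>: "\<rho> > 0" using s by (simp add: \<rho>_def)
    define w where "w n x = exp (- (norm x / real (Suc n))\<^sup>2 / 2)" for n and x :: 'a
    define c where "c n = (real (Suc n) * sqrt (2 * pi)) ^ DIM('a)" for n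
    have w_gauss: "integrable lborel (\<lambda>x::'a. complex_of_real (w n x) * cis (\<xi> \<bullet> x))"
        "(LINT x|lborel. complex_of_real (w n x) * cis (\<xi> \<bullet> x)) =
           complex_of_real (c n * exp (- (real (Suc n) * norm \<xi>)\<^sup>2 / 2))" for n and \<xi> :: 'a
      using integrable_gauss_cis_inner[of "real (Suc n)" \<xi>] integral_gauss_cis_inner[of "real (Suc n)" \<xi>]
      by (simp_all add: w_def c_def del: of_nat_Suc)
    have wint: "integrable lborel (w n)" for n
      using integrable_norm[OF w_gauss(1)[of n 0]] by (simp add: w_def[abs_def])
    have [measurable]: "w n \<in> borel_measurable borel" for n using wint[of n] by auto
    have w01: "0 \<le> w n x" "w n x \<le> 1" for n x by (auto simp: w_def)
    have eq: "(LINT x|lborel. complex_of_real (K x) * cis (- (s \<bullet> x)) * of_real (w n x)) =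
        (LINT t|M. complex_of_real (c n * exp (- (real (Suc n) * norm (t - s))\<^sup>2 / 2)))" for n
    proof -
      have mix: "cis (t \<bullet> x) * cis (- (s \<bullet> x)) * of_real (w n x) = complex_of_real (w n x) * cis ((t - s) \<bullet> x)" for t x
        by (simp add: cis_mult inner_diff_left)
      have "(LINT x|lborel. complex_of_real (K x) * cis (- (s \<bullet> x)) * of_real (w n x)) =
        (LINT x|lborel. LINT t|M. complex_of_real (w n x) * cis ((t - s) \<bullet> x))"
        unfolding K mix[symmetric] by simp
      also have "\<dots> = (LINT t|M. LINT x|lborel. complex_of_real (w n x) * cis ((t - s) \<bullet> x))"
      proof (rule P.Fubini_integral)
        have "integrable (M \<Otimes>\<^sub>M lborel) (\<lambda>p. w n (snd p))"
        proof (rule P.Fubini_integrable)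
          show "integrable M (\<lambda>x. LINT y|lborel. norm (w n (snd (x, y))))"
            by simp
          show "AE x in M. integrable lborel (\<lambda>y. w n (snd (x, y)))"
            using wint by simp
        qed measurable
        then show "integrable (M \<Otimes>\<^sub>M lborel) (\<lambda>(t, x). complex_of_real (w n x) * cis ((t - s) \<bullet> x))"
        proof (rule Bochner_Integration.integrable_bound)
          show "AE p in M \<Otimes>\<^sub>M lborel. norm (case p of (t, x) \<Rightarrow> complex_of_real (w n x) * cis ((t - s) \<bullet> x))
             \<le> norm (w n (snd p))"
            by (rule AE_I2) (simp add: split_beta norm_mult)
        qed measurable
      qed
      also have "\<dots> = (LINT t|M. complex_of_real (c n * exp (- (real (Suc n) * norm (t - s))\<^sup>2 / 2)))"
        by (simp only: w_gauss(2))
      finally show ?thesis .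
    qed
    have "(\<lambda>n. LINT x|lborel. complex_of_real (K x) * cis (- (s \<bullet> x)) * of_real (w n x)) \<longlonglongrightarrow> fourier K s"
      unfolding fourier_eq_cis
    proof (rule integral_dominated_convergence[where w="\<lambda>x. \<bar>K x\<bar>"])
      have "\<bar>K x\<bar> * w n x \<le> \<bar>K x\<bar> * 1" for n x by (intro mult_left_mono w01) auto
      then show "AE x in lborel. norm (complex_of_real (K x) * cis (- (s \<bullet> x)) * of_real (w n x)) \<le> \<bar>K x\<bar>" for n
        by (simp add: norm_mult w01)
      have "(\<lambda>n. complex_of_real (K x) * cis (- (s \<bullet> x)) * of_real (w n x)) \<longlonglongrightarrow> complex_of_real (K x) * cis (- (s \<bullet> x)) * of_real 1" for x
        unfolding w_def by (intro tendsto_intros gauss_weight_tendsto_1)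
      then show "AE x in lborel. (\<lambda>n. complex_of_real (K x) * cis (- (s \<bullet> x)) * of_real (w n x)) \<longlonglongrightarrow> complex_of_real (K x) * cis (- (s \<bullet> x))"
        by simp
    qed (use int in auto)
    moreover have "(\<lambda>n. LINT x|lborel. complex_of_real (K x) * cis (- (s \<bullet> x)) * of_real (w n x)) \<longlonglongrightarrow> 0"
    proof (rule Lim_null_comparison[OF always_eventually poly_gauss_tendsto_0[OF \<rho>]], rule allI)
      fix n
      let ?e = "c n * exp (- (real (Suc n) * \<rho>)\<^sup>2 / 2)"
      have c0: "c n \<ge> 0" by (simp add: c_def)
      have "norm (LINT t|M. complex_of_real (c n * exp (- (real (Suc n) * norm (t - s))\<^sup>2 / 2))) \<le> (LINT t|M. ?e)"
      proof (rule order_trans[OF integral_norm_bound integral_mono_AE])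
        show "AE t in M. norm (complex_of_real (c n * exp (- (real (Suc n) * norm (t - s))\<^sup>2 / 2))) \<le> ?e"
          using R
        proof eventually_elim
          case (elim t)
          have "\<rho> \<le> norm (t - s)" using elim norm_triangle_ineq2[of s t] by (simp add: \<rho>_def norm_minus_commute)
          then have "(real (Suc n) * \<rho>)\<^sup>2 \<le> (real (Suc n) * norm (t - s))\<^sup>2"
            using \<rho> by (intro power_mono mult_left_mono) auto
          then have "c n * exp (- (real (Suc n) * norm (t - s))\<^sup>2 / 2) \<le> ?e"
            using c0 by (intro mult_left_mono) auto
          then show ?case using c0 by (simp only: norm_of_real abs_mult abs_exp_cancel abs_of_nonneg)
        qed
        show "integrable M (\<lambda>t. norm (complex_of_real (c n * exp (- (real (Suc n) * norm (t - s))\<^sup>2 / 2))))"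
        proof (intro M.integrable_const_bound[where B="c n"] AE_I2)
          show "norm (norm (complex_of_real (c n * exp (- (real (Suc n) * norm (t - s))\<^sup>2 / 2)))) \<le> c n" for t
            using c0 mult_left_mono[of "exp (- (real (Suc n) * norm (t - s))\<^sup>2 / 2)" 1 "c n"]
            by (simp only: norm_of_real abs_mult abs_exp_cancel abs_of_nonneg real_norm_def) simp
        qed measurable
      qed simp
      then show "norm (LINT x|lborel. complex_of_real (K x) * cis (- (s \<bullet> x)) * of_real (w n x)) \<le>
         measure M (space M) * ((real (Suc n) * sqrt (2 * pi)) ^ DIM('a) * exp (- (real (Suc n) * \<rho>)\<^sup>2 / 2))"
        unfolding eq c_def by simp
    qed
    ultimately show ?thesis by (rule LIMSEQ_unique)
  qed
  then show ?thesis by (rule that)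
qed


section \<open>Convolution\<close>

text \<open>The convolution \<open>f * K\<close>; it has its usual meaning where the integrand is integrable.\<close>

definition convolve :: "('a::euclidean_space \<Rightarrow> real) \<Rightarrow> ('a \<Rightarrow> real) \<Rightarrow> 'a \<Rightarrow> real" where
  "convolve f K x = (LINT y|lborel. f y * K (x - y))"

lemma compact_spectrum_abs_le: "compact_spectrum K \<Longrightarrow> \<bar>K x\<bar> \<le> K 0"
  by (intro positive_definite_abs_le compact_spectrum_positive_definite)

lemma compact_spectrum_measurable: "compact_spectrum K \<Longrightarrow> K \<in> borel_measurable borel"
  by (intro borel_measurable_continuous_onI compact_spectrum_continuous)

lemma norm_fourier_le:
  assumes "integrable lborel f"
  shows "norm (fourier f s) \<le> (LINT x|lborel. \<bar>f x\<bar>)"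
  unfolding fourier_eq_cis
  by (rule order_trans[OF integral_norm_bound]) (simp add: norm_mult)

text \<open>
  By Fubini, \<open>f * K\<close> is the transform of the measure of \<open>K\<close> with the nonnegative density
  \<open>fourier f\<close>.
\<close>

lemma positive_definite_convolve:
  fixes f :: "'a::euclidean_space \<Rightarrow> real"
  assumes cont: "continuous_on UNIV f" and pd: "positive_definite f" and int: "integrable lborel f"
    and K: "compact_spectrum K"
  shows "positive_definite (convolve f K)"
proof -
  obtain M where M: "finite_measure M" and sM[measurable_cong]: "sets M = sets borel"
    and K: "\<And>x. complex_of_real (K x) = (LINT s|M. cis (s \<bullet> x))"
    using K unfolding compact_spectrum_def by blast
  interpret M: finite_measure M by fact
  interpret P: pair_sigma_finite M "lborel :: 'a measure" ..
  have [measurable]: "f \<in> borel_measurable borel" using int by auto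
  have [measurable]: "fourier f \<in> borel_measurable borel"
    unfolding fourier_eq_cis[abs_def] by measurable
  have eq: "complex_of_real (convolve f K x) = (LINT s|M. fourier f s * cis (s \<bullet> x))" for x
  proof -
    have mix: "complex_of_real (f y) * cis (s \<bullet> (x - y)) = (complex_of_real (f y) * cis (- (s \<bullet> y))) * cis (s \<bullet> x)" for s y
      by (simp add: cis_mult inner_diff_right mult.assoc)
    have "complex_of_real (convolve f K x) = (LINT y|lborel. complex_of_real (f y) * complex_of_real (K (x - y)))"
      unfolding convolve_def by (subst integral_complex_of_real[symmetric]) simp
    also have "\<dots> = (LINT y|lborel. LINT s|M. (complex_of_real (f y) * cis (- (s \<bullet> y))) * cis (s \<bullet> x))"
      unfolding K mix[symmetric] by simp
    also have "\<dots> = (LINT s|M. LINT y|lborel. (complex_of_real (f y) * cis (- (s \<bullet> y))) * cis (s \<bullet> x))"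
    proof (rule P.Fubini_integral)
      have "integrable (M \<Otimes>\<^sub>M lborel) (\<lambda>p. f (snd p))"
      proof (rule P.Fubini_integrable)
        show "integrable M (\<lambda>x. LINT y|lborel. norm (f (snd (x, y))))"
          by simp
        show "AE x in M. integrable lborel (\<lambda>y. f (snd (x, y)))"
          using int by simp
      qed measurable
      then show "integrable (M \<Otimes>\<^sub>M lborel) (\<lambda>(s, y). (complex_of_real (f y) * cis (- (s \<bullet> y))) * cis (s \<bullet> x))"
      proof (rule Bochner_Integration.integrable_bound)
        show "AE p in M \<Otimes>\<^sub>M lborel. norm (case p of (s, y) \<Rightarrow> (complex_of_real (f y) * cis (- (s \<bullet> y))) * cis (s \<bullet> x))
           \<le> norm (f (snd p))"
          by (rule AE_I2) (simp add: split_beta norm_mult)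
      qed measurable
    qed
    also have "\<dots> = (LINT s|M. fourier f s * cis (s \<bullet> x))"
      by (simp add: fourier_eq_cis)
    finally show ?thesis .
  qed
  show ?thesis
    unfolding positive_definite_iff_psd_kernel eq
  proof (rule psd_kernel_integral)
    fix s
    obtain a where a: "fourier f s = complex_of_real a" "a \<ge> 0"
      using fourier_nonneg[OF cont pd int, of s] by (auto elim!: nonneg_Reals_cases)
    have "psd_kernel (\<lambda>x y. complex_of_real (sqrt a) * cnj (complex_of_real (sqrt a)) * cis (s \<bullet> (x - y)))"
      by (rule psd_kernel_mult_rank_one[OF psd_kernel_cis])
    also have "complex_of_real (sqrt a) * cnj (complex_of_real (sqrt a)) = fourier f s"
      using a by (simp flip: of_real_mult)
    finally show "psd_kernel (\<lambda>x y. fourier f s * cis (s \<bullet> (x - y)))" .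
  next
    show "integrable M (\<lambda>s. fourier f s * cis (s \<bullet> (x - y)))" for x y
      by (rule M.integrable_const_bound[where B="LINT x|lborel. \<bar>f x\<bar>"])
         (auto simp: norm_mult norm_fourier_le[OF int])
  qed
qed

lemma continuous_on_convolve:
  fixes f :: "'a::euclidean_space \<Rightarrow> real"
  assumes int: "integrable lborel f" and K: "compact_spectrum K"
  shows "continuous_on UNIV (convolve f K)"
proof -
  note [measurable] = compact_spectrum_measurable[OF K]
  have [measurable]: "f \<in> borel_measurable borel" using int by auto
  have "isCont (\<lambda>x. LINT y|lborel. f y * K (x - y)) x" for x
  proof (subst continuous_at_sequentially, intro allI impI)
    fix X assume X: "X \<longlonglongrightarrow> x"
    show "((\<lambda>x. LINT y|lborel. f y * K (x - y)) \<circ> X) \<longlonglongrightarrow> (LINT y|lborel. f y * K (x - y))"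
      unfolding comp_def
    proof (rule integral_dominated_convergence[where w="\<lambda>y. \<bar>f y\<bar> * K 0"])
      have "(\<lambda>n. f y * K (X n - y)) \<longlonglongrightarrow> f y * K (x - y)" for y
        by (intro tendsto_intros X continuous_on_tendsto_compose[OF compact_spectrum_continuous[OF K]]) auto
      then show "AE y in lborel. (\<lambda>n. f y * K (X n - y)) \<longlonglongrightarrow> f y * K (x - y)" by simp
      show "AE y in lborel. norm (f y * K (X n - y)) \<le> \<bar>f y\<bar> * K 0" for n
        by (auto simp: abs_mult intro!: mult_left_mono compact_spectrum_abs_le[OF K])
    qed (use int in auto)
  qed
  then show ?thesis
    by (simp add: continuous_on_eq_continuous_at convolve_def[abs_def])
qed

lemma
  fixes g :: "'a::euclidean_space \<Rightarrow> 'b::{banach, second_countable_topology}"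
  assumes g: "integrable lborel g"
  shows lborel_integrable_translate: "integrable lborel (\<lambda>x. g (x - y))"
    and lborel_integral_translate: "(LINT x|lborel. g (x - y)) = (LINT x|lborel. g x)"
proof -
  have [measurable]: "g \<in> borel_measurable borel" using g by auto
  from g have "integrable (distr lborel borel ((+) (- y))) g"
    by (simp add: lborel_distr_plus)
  then show "integrable lborel (\<lambda>x. g (x - y))"
    by (subst (asm) integrable_distr_eq) auto
  have "(LINT x|distr lborel borel ((+) (- y)). g x) = (LINT x|lborel. g (x - y))"
    by (subst integral_distr) auto
  then show "(LINT x|lborel. g (x - y)) = (LINT x|lborel. g x)"
    by (simp add: lborel_distr_plus)
qed

lemma
  fixes f K :: "'a::euclidean_space \<Rightarrow> real"
  assumes f: "integrable lborel f" and K: "integrable lborel K"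
  shows integrable_convolve: "integrable lborel (convolve f K)"
    and fourier_convolve: "fourier (convolve f K) s = fourier f s * fourier K s"
proof -
  have [measurable]: "f \<in> borel_measurable borel" "K \<in> borel_measurable borel" using f K by auto
  have prod: "integrable (lborel \<Otimes>\<^sub>M lborel) (\<lambda>(y, x). f y * K (x - y))"
  proof (rule lborel_pair.Fubini_integrable)
    have "(\<lambda>y. LINT x|lborel. norm (case (y, x) of (y, x) \<Rightarrow> f y * K (x - y))) =
        (\<lambda>y. \<bar>f y\<bar> * (LINT x|lborel. \<bar>K x\<bar>))"
      using lborel_integral_translate[OF integrable_abs[OF K]] by (simp add: abs_mult)
    then show "integrable lborel (\<lambda>y. LINT x|lborel. norm (case (y, x) of (y, x) \<Rightarrow> f y * K (x - y)))"
      using f by simp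
    show "AE y in lborel. integrable lborel (\<lambda>x. case (y, x) of (y, x) \<Rightarrow> f y * K (x - y))"
      using lborel_integrable_translate[OF K] by simp
  qed measurable
  have "integrable lborel (\<lambda>x. LINT y|lborel. f y * K (x - y))"
    using lborel_pair.integrable_snd[OF prod] .
  then show "integrable lborel (convolve f K)"
    by (simp add: convolve_def[abs_def])
  have prod': "integrable (lborel \<Otimes>\<^sub>M lborel) (\<lambda>(y, x). complex_of_real (f y * K (x - y)) * cis (- (s \<bullet> x)))"
  proof (rule Bochner_Integration.integrable_bound[OF prod])
    show "AE p in lborel \<Otimes>\<^sub>M lborel. norm (case p of (y, x) \<Rightarrow> complex_of_real (f y * K (x - y)) * cis (- (s \<bullet> x)))
       \<le> norm (case p of (y, x) \<Rightarrow> f y * K (x - y))"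
      by (rule AE_I2) (simp add: split_beta norm_mult)
  qed measurable
  have "fourier (convolve f K) s = (LINT x|lborel. LINT y|lborel. complex_of_real (f y * K (x - y)) * cis (- (s \<bullet> x)))"
    unfolding fourier_eq_cis convolve_def
    by (simp only: integral_complex_of_real[symmetric] integral_mult_left_zero)
  also have "\<dots> = (LINT y|lborel. LINT x|lborel. complex_of_real (f y * K (x - y)) * cis (- (s \<bullet> x)))"
    by (rule lborel_pair.Fubini_integral[OF prod'])
  also have "\<dots> = (LINT y|lborel. complex_of_real (f y) * cis (- (s \<bullet> y)) * fourier K s)"
  proof (rule Bochner_Integration.integral_cong[OF refl])
    fix y
    have int: "integrable lborel (\<lambda>x. complex_of_real (K x) * cis (- (s \<bullet> x)))"
      using integrable_fourier_integrand[OF K, of s] by (simp add: cis_conv_exp)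
    have "complex_of_real (f y * K (x - y)) * cis (- (s \<bullet> x)) =
       (complex_of_real (f y) * cis (- (s \<bullet> y))) * (complex_of_real (K (x - y)) * cis (- (s \<bullet> (x - y))))" for x
    proof -
      have "cis (- (s \<bullet> x)) = cis (- (s \<bullet> y)) * cis (- (s \<bullet> (x - y)))"
        by (simp add: cis_mult inner_diff_right)
      then show ?thesis by (simp only: of_real_mult mult_ac)
    qed
    then have "(LINT x|lborel. complex_of_real (f y * K (x - y)) * cis (- (s \<bullet> x))) =
       (complex_of_real (f y) * cis (- (s \<bullet> y))) * (LINT x|lborel. complex_of_real (K (x - y)) * cis (- (s \<bullet> (x - y))))"
      by (simp only: integral_mult_right_zero)
    also have "(LINT x|lborel. complex_of_real (K (x - y)) * cis (- (s \<bullet> (x - y)))) = fourier K s"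
      unfolding fourier_eq_cis by (rule lborel_integral_translate[OF int])
    finally show "(LINT x|lborel. complex_of_real (f y * K (x - y)) * cis (- (s \<bullet> x))) =
      complex_of_real (f y) * cis (- (s \<bullet> y)) * fourier K s" .
  qed
  also have "\<dots> = fourier f s * fourier K s"
    unfolding fourier_eq_cis[of f] by (simp only: integral_mult_left_zero)
  finally show "fourier (convolve f K) s = fourier f s * fourier K s" .
qed

section \<open>The transform of the truncated cosine\<close>

text \<open>The Fourier transform of the cosine cut off at its first zeros \<open>-\<pi>/2\<close> and \<open>\<pi>/2\<close>.\<close>

definition cosine_window :: "real \<Rightarrow> real" where
  "cosine_window x = (LINT t|lborel. indicator {- (pi / 2)..pi / 2} t *\<^sub>R (cos t * cos (x * t)))"

lemma integral_window:
  fixes f :: "real \<Rightarrow> real"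
  assumes "\<And>t. (F has_real_derivative f t) (at t)" "continuous_on UNIV f"
  shows "(LINT t|lborel. indicator {- (pi / 2)..pi / 2} t *\<^sub>R f t) = F (pi / 2) - F (- (pi / 2))"
proof (rule integral_FTC_atLeastAtMost)
  show "- (pi / 2) \<le> pi / 2" by (simp add: pi_ge_zero)
  show "(F has_vector_derivative f t) (at t within {- (pi / 2)..pi / 2})" for t
    using assms(1)[of t] has_vector_derivative_at_within
    by (auto simp: has_real_derivative_iff_has_vector_derivative)
  show "continuous_on {- (pi / 2)..pi / 2} f"
    using assms(2) by (rule continuous_on_subset) auto
qed

lemma integrable_window:
  fixes f :: "real \<Rightarrow> 'b::{banach, second_countable_topology}"
  assumes "continuous_on UNIV f"
  shows "integrable lborel (\<lambda>t. indicator {- (pi / 2)..pi / 2} t *\<^sub>R f t)"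
  using borel_integrable_atLeastAtMost'[of "- (pi / 2)" "pi / 2" f] continuous_on_subset[OF assms]
  by (auto simp: set_integrable_def)

lemma continuous_on_cos_real: "continuous_on UNIV (cos :: real \<Rightarrow> real)"
  by (intro continuous_on_cos continuous_on_id)

text \<open>
  The cut-off cosine vanishes at the cut-off points, so its second derivative is its negative plus two
  positive point masses there; their transform is the right-hand side.
\<close>

lemma cosine_window_eq: "(1 - x\<^sup>2) * cosine_window x = 2 * cos (x * (pi / 2))"
proof -
  have "(1 - x\<^sup>2) * cosine_window x =
     (LINT t|lborel. indicator {- (pi / 2)..pi / 2} t *\<^sub>R ((1 - x\<^sup>2) * (cos t * cos (x * t))))"
    unfolding cosine_window_def
    by (subst integral_mult_right_zero[symmetric]) (simp add: mult_ac)
  also have "\<dots> = (sin (pi / 2) * cos (x * (pi / 2)) - x * cos (pi / 2) * sin (x * (pi / 2))) -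
     (sin (- (pi / 2)) * cos (x * (- (pi / 2))) - x * cos (- (pi / 2)) * sin (x * (- (pi / 2))))"
  proof (rule integral_window)
    show "((\<lambda>t. sin t * cos (x * t) - x * cos t * sin (x * t)) has_real_derivative (1 - x\<^sup>2) * (cos t * cos (x * t))) (at t)" for t
      by (auto intro!: derivative_eq_intros simp: power2_eq_square algebra_simps)
  qed (intro continuous_intros)
  also have "\<dots> = 2 * cos (x * (pi / 2))" by simp
  finally show ?thesis .
qed

lemma abs_cosine_window_le_2: "\<bar>cosine_window x\<bar> \<le> 2"
proof -
  have cos_int: "(LINT t|lborel. indicator {- (pi / 2)..pi / 2} t *\<^sub>R cos t) = 2"
    using integral_window[OF DERIV_sin continuous_on_cos_real] by simp
  have "norm (cosine_window x) \<le> (LINT t|lborel. indicator {- (pi / 2)..pi / 2} t *\<^sub>R cos t)"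
    unfolding cosine_window_def
  proof (rule Bochner_Integration.integral_norm_bound_integral)
    show "norm (indicator {- (pi / 2)..pi / 2} t *\<^sub>R (cos t * cos (x * t))) \<le> indicator {- (pi / 2)..pi / 2} t *\<^sub>R cos t" for t
    proof (cases "t \<in> {- (pi / 2)..pi / 2}")
      case True
      then have "cos t \<ge> 0" by (intro cos_ge_zero) auto
      then have "cos t * \<bar>cos (x * t)\<bar> \<le> cos t * 1" by (intro mult_left_mono) auto
      with True \<open>cos t \<ge> 0\<close> show ?thesis by (simp add: abs_mult)
    qed auto
  qed (intro integrable_window continuous_intros)+
  then show ?thesis unfolding cos_int by simp
qed

lemma abs_cosine_window_le: "\<bar>cosine_window x\<bar> \<le> 6 / (1 + x\<^sup>2)"
proof -
  have pos: "1 + x\<^sup>2 > 0" by (simp add: add_pos_nonneg)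
  \<comment> \<open>write \<open>1 + x\<^sup>2\<close> as \<open>2 - (1 - x\<^sup>2)\<close>, so that no division by \<open>1 - x\<^sup>2\<close> occurs\<close>
  have "(1 + x\<^sup>2) * \<bar>cosine_window x\<bar> = \<bar>(1 + x\<^sup>2) * cosine_window x\<bar>"
    using pos by (simp add: abs_mult)
  also have "(1 + x\<^sup>2) * cosine_window x = 2 * cosine_window x - (1 - x\<^sup>2) * cosine_window x"
    by (simp add: algebra_simps)
  also have "\<bar>\<dots>\<bar> = \<bar>2 * cosine_window x - 2 * cos (x * (pi / 2))\<bar>"
    unfolding cosine_window_eq ..
  also have "\<dots> \<le> 2 * \<bar>cosine_window x\<bar> + 2 * \<bar>cos (x * (pi / 2))\<bar>"
    by linarith
  also have "\<dots> \<le> 6"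
    using abs_cosine_window_le_2[of x] abs_cos_le_one[of "x * (pi / 2)"] by linarith
  finally show ?thesis using pos by (simp add: field_simps)
qed

lemma cosine_window_0: "cosine_window 0 = 2"
  using cosine_window_eq[of 0] by simp

lemma cosine_window_ge_1:
  assumes "\<bar>x\<bar> \<le> 1"
  shows "cosine_window x \<ge> 1"
proof -
  have cos2: "(LINT t|lborel. indicator {- (pi / 2)..pi / 2} t *\<^sub>R (cos t * cos t)) = pi / 2"
  proof (subst integral_window[of "\<lambda>t. (t + sin t * cos t) / 2"])
    show "((\<lambda>t. (t + sin t * cos t) / 2) has_real_derivative cos t * cos t) (at t)" for t
    proof (rule DERIV_cong)
      show "((\<lambda>t. (t + sin t * cos t) / 2) has_real_derivative (1 + (cos t * cos t - sin t * sin t)) / 2) (at t)"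
        by (auto intro!: derivative_eq_intros)
      show "(1 + (cos t * cos t - sin t * sin t)) / 2 = cos t * cos t"
        using sin_cos_squared_add[of t] by (simp add: power2_eq_square)
    qed
  qed (auto intro!: continuous_intros)
  have "(LINT t|lborel. indicator {- (pi / 2)..pi / 2} t *\<^sub>R (cos t * cos t)) \<le> cosine_window x"
    unfolding cosine_window_def
  proof (rule integral_mono)
    show "indicator {- (pi / 2)..pi / 2} t *\<^sub>R (cos t * cos t) \<le> indicator {- (pi / 2)..pi / 2} t *\<^sub>R (cos t * cos (x * t))" for t
    proof (cases "t \<in> {- (pi / 2)..pi / 2}")
      case True
      then have "cos t \<ge> 0" by (intro cos_ge_zero) auto
      \<comment> \<open>for \<open>\<bar>x\<bar> \<le> 1\<close> the integrand is at least \<open>cos\<^sup>2 t\<close>\<close>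
      moreover have "cos \<bar>t\<bar> \<le> cos \<bar>x * t\<bar>"
      proof (rule cos_monotone_0_pi_le)
        show "\<bar>x * t\<bar> \<le> \<bar>t\<bar>"
          using mult_right_mono[OF assms, of "\<bar>t\<bar>"] by (simp add: abs_mult)
        show "\<bar>t\<bar> \<le> pi" using True by auto
      qed simp
      ultimately show ?thesis using True by (auto intro: mult_left_mono)
    qed auto
  qed (intro integrable_window continuous_intros)+
  then show ?thesis using cos2 pi_ge_two by linarith
qed

lemma compact_spectrum_cosine_window:
  fixes v :: "'a::euclidean_space"
  shows "compact_spectrum (\<lambda>x. cosine_window (v \<bullet> x))"
proof -
  let ?I = "{- (pi / 2)..pi / 2}"
  define D where "D = density lborel (\<lambda>t. ennreal (indicator ?I t * cos t))"
  define M where "M = distr D borel (\<lambda>t. t *\<^sub>R v)"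
  have nn: "0 \<le> indicator ?I t * cos t" for t :: real
    by (auto simp: indicator_def intro: cos_ge_zero)
  have Dfin: "finite_measure D"
  proof (rule finite_measureI)
    have "integrable lborel (\<lambda>t. indicator ?I t * cos t)"
      using integrable_window[OF continuous_on_cos_real] by simp
    then have "(\<integral>\<^sup>+t. ennreal (indicator ?I t * cos t) \<partial>lborel) < \<infinity>"
      using nn by (subst nn_integral_eq_integral) auto
    then show "emeasure D (space D) \<noteq> \<infinity>"
      by (simp add: D_def emeasure_density)
  qed
  show ?thesis
    unfolding compact_spectrum_def
  proof (intro exI conjI allI)
    show "finite_measure M"
      unfolding M_def by (rule finite_measure.finite_measure_distr[OF Dfin]) (simp add: D_def)
    show "sets M = sets borel" by (simp add: M_def)
    have "AE t in D. norm (t *\<^sub>R v) \<le> pi / 2 * norm v"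
      unfolding D_def
    proof (subst AE_density, simp, rule AE_I2, rule impI)
      fix t :: real assume "0 < ennreal (indicator ?I t * cos t)"
      then have "t \<in> ?I" by (cases "t \<in> ?I") simp_all
      then have "\<bar>t\<bar> \<le> pi / 2" by auto
      then show "norm (t *\<^sub>R v) \<le> pi / 2 * norm v"
        unfolding norm_scaleR by (rule mult_right_mono) simp
    qed
    then show "AE s in M. norm s \<le> pi / 2 * norm v"
      unfolding M_def by (subst AE_distr_iff) (auto simp: D_def)
    fix x
    have "(LINT s|M. cis (s \<bullet> x)) = (LINT t|D. cis (t * (v \<bullet> x)))"
      unfolding M_def by (subst integral_distr) (auto simp: D_def)
    also have "\<dots> = (LINT t|lborel. (indicator ?I t * cos t) *\<^sub>R cis (t * (v \<bullet> x)))"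
      unfolding D_def by (subst integral_density) (use nn in auto)
    also have "\<dots> = (LINT t|lborel. complex_of_real (indicator ?I t *\<^sub>R (cos t * cos ((v \<bullet> x) * t))) +
        \<i> * complex_of_real (indicator ?I t *\<^sub>R (cos t * sin ((v \<bullet> x) * t))))"
      by (intro Bochner_Integration.integral_cong) (auto simp: complex_eq_iff indicator_def mult_ac)
    also have "\<dots> = complex_of_real (cosine_window (v \<bullet> x)) +
       \<i> * complex_of_real (LINT t|lborel. indicator ?I t *\<^sub>R (cos t * sin ((v \<bullet> x) * t)))"
      unfolding cosine_window_def integral_complex_of_real[symmetric]
      by (subst Bochner_Integration.integral_add)
         (auto intro!: integrable_of_real integrable_window continuous_intros integrable_mult_right
            simp del: real_scaleR_def)
    also have "(LINT t|lborel. indicator ?I t *\<^sub>R (cos t * sin ((v \<bullet> x) * t))) = 0"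
    proof -
      let ?h = "\<lambda>t. indicator ?I t *\<^sub>R (cos t * sin ((v \<bullet> x) * t)) :: real"
      have "integral\<^sup>L lborel ?h = (LINT t|lborel. ?h (0 + (- 1) * t))"
        by (subst lborel_integral_real_affine[where c="-1" and t=0]) auto
      also have "(\<lambda>t. ?h (0 + (- 1) * t)) = (\<lambda>t. - ?h t)"
      proof
        fix t
        have "0 + (- 1) * t \<in> ?I \<longleftrightarrow> t \<in> ?I" unfolding atLeastAtMost_iff by linarith
        then have "indicator ?I (0 + (- 1) * t) = (indicator ?I t :: real)"
          by (simp only: indicator_def)
        then show "?h (0 + (- 1) * t) = - ?h t" by (simp only:) simp
      qed
      finally show ?thesis by simp
    qed
    finally show "complex_of_real (cosine_window (v \<bullet> x)) = (LINT s|M. cis (s \<bullet> x))" by simp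
  qed
qed

text \<open>
  The squared windows at \<open>x\<close> and \<open>2 x\<close> have no common zero: with \<open>c = cos (\<pi> x / 2)\<close> the sum of
  the numerators is \<open>4 c\<^sup>2 + 4 (2 c\<^sup>2 - 1)\<^sup>2\<close>, which is at least \<open>7/4\<close>.
\<close>

lemma cosine_window_squares:
  "cosine_window x ^ 2 + cosine_window (2 * x) ^ 2 \<ge> (7 / 4) / (1 + 4 * x\<^sup>2)\<^sup>2"
proof -
  let ?u = "cosine_window x" and ?w = "cosine_window (2 * x)" and ?c = "cos (x * (pi / 2))"
  have "((1 - x\<^sup>2) * ?u)\<^sup>2 + ((1 - (2 * x)\<^sup>2) * ?w)\<^sup>2 = 4 * ?c\<^sup>2 + 4 * (2 * ?c\<^sup>2 - 1)\<^sup>2"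
  proof -
    have "cos (2 * x * (pi / 2)) = 2 * ?c\<^sup>2 - 1"
      using cos_double_cos[of "x * (pi / 2)"] by (simp add: mult_ac)
    then show ?thesis
      unfolding cosine_window_eq by (simp only: power_mult_distrib) simp
  qed
  also have "\<dots> = 16 * (?c\<^sup>2 - 3 / 8)\<^sup>2 + 7 / 4"
    by (simp add: power2_eq_square algebra_simps)
  also have "\<dots> \<ge> 7 / 4" by simp
  finally have "7 / 4 \<le> ((1 - x\<^sup>2) * ?u)\<^sup>2 + ((1 - (2 * x)\<^sup>2) * ?w)\<^sup>2" .
  also have "\<dots> \<le> (1 + 4 * x\<^sup>2)\<^sup>2 * ?u\<^sup>2 + (1 + 4 * x\<^sup>2)\<^sup>2 * ?w\<^sup>2"
  proof -
    have a: "\<bar>1 - x\<^sup>2\<bar> \<le> 1 + 4 * x\<^sup>2" and b: "\<bar>1 - (2 * x)\<^sup>2\<bar> \<le> 1 + 4 * x\<^sup>2"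
      using zero_le_power2[of x] by (auto simp: abs_le_iff power_mult_distrib)
    have "(1 - x\<^sup>2)\<^sup>2 \<le> (1 + 4 * x\<^sup>2)\<^sup>2" "(1 - (2 * x)\<^sup>2)\<^sup>2 \<le> (1 + 4 * x\<^sup>2)\<^sup>2"
      using power_mono[OF a, of 2] power_mono[OF b, of 2] by auto
    then show ?thesis
      unfolding power_mult_distrib[of "1 - _"] by (intro add_mono mult_right_mono) auto
  qed
  also have "\<dots> = (1 + 4 * x\<^sup>2)\<^sup>2 * (?u\<^sup>2 + ?w\<^sup>2)" by (simp add: algebra_simps)
  finally have "7 / 4 \<le> (1 + 4 * x\<^sup>2)\<^sup>2 * (?u\<^sup>2 + ?w\<^sup>2)" .
  moreover have "1 + 4 * x\<^sup>2 > 0" by (simp add: add_pos_nonneg)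
  then have "(1 + 4 * x\<^sup>2)\<^sup>2 > 0" by (rule zero_less_power)
  ultimately show ?thesis by (simp add: field_simps)
qed

section \<open>Bandlimited positive definite functions\<close>

text \<open>
  The conditions of the bandlimited class other than normalisation and sign, with compactness of the
  support of the transform stated as vanishing outside a ball. These functions form a convex cone.
\<close>

definition bandlimited_pd :: "('a::euclidean_space \<Rightarrow> real) \<Rightarrow> bool" where
  "bandlimited_pd F \<longleftrightarrow> continuous_on UNIV F \<and> integrable lborel F \<and> positive_definite F \<and>
     (\<exists>R. \<forall>s. norm s > R \<longrightarrow> fourier F s = 0)"

lemma bandlimited_pd_compact_spectrum:
  "compact_spectrum K \<Longrightarrow> integrable lborel K \<Longrightarrow> bandlimited_pd K"
  unfolding bandlimited_pd_def
  by (metis compact_spectrum_continuous compact_spectrum_positive_definite fourier_compact_spectrum_vanishes)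

lemma fourier_add:
  assumes "integrable lborel F" "integrable lborel G"
  shows "fourier (\<lambda>x. F x + G x) s = fourier F s + fourier G s"
  using assms[THEN integrable_fourier_integrand, of s] by (simp add: fourier_def ring_distribs)

lemma fourier_scale: "fourier (\<lambda>x. c * F x) s = of_real c * fourier F s"
  by (simp add: fourier_def mult.assoc)

lemma bandlimited_pd_add:
  assumes "bandlimited_pd F" "bandlimited_pd G"
  shows "bandlimited_pd (\<lambda>x. F x + G x)"
proof -
  obtain R S where R: "\<And>s. norm s > R \<Longrightarrow> fourier F s = 0" and S: "\<And>s. norm s > S \<Longrightarrow> fourier G s = 0"
    using assms unfolding bandlimited_pd_def by blast
  have "\<forall>s. norm s > max R S \<longrightarrow> fourier (\<lambda>x. F x + G x) s = 0"
    using assms R S by (simp add: bandlimited_pd_def fourier_add)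
  then show ?thesis
    using assms unfolding bandlimited_pd_def
    by (intro conjI continuous_on_add Bochner_Integration.integrable_add positive_definite_add) blast+
qed

lemma bandlimited_pd_scale:
  assumes "bandlimited_pd F" "c \<ge> 0"
  shows "bandlimited_pd (\<lambda>x. c * F x)"
proof -
  obtain R where R: "\<And>s. norm s > R \<Longrightarrow> fourier F s = 0"
    using assms unfolding bandlimited_pd_def by blast
  have "\<forall>s. norm s > R \<longrightarrow> fourier (\<lambda>x. c * F x) s = 0"
    by (simp add: R fourier_scale)
  then show ?thesis
    using assms unfolding bandlimited_pd_def
    by (intro conjI continuous_on_mult_left integrable_mult_right positive_definite_scale) blast+
qed

lemma bandlimited_pd_sum:
  "(\<And>i. i \<in> I \<Longrightarrow> bandlimited_pd (F i)) \<Longrightarrow> bandlimited_pd (\<lambda>x. \<Sum>i\<in>I. F i x)"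
proof (induction I rule: infinite_finite_induct)
  case (insert i I)
  then show ?case by (simp add: bandlimited_pd_add)
qed (auto simp: bandlimited_pd_def positive_definite_def fourier_def)

lemma bandlimited_pd_convolve:
  assumes "continuous_on UNIV f" "positive_definite f" "integrable lborel f"
    and "compact_spectrum K" "integrable lborel K"
  shows "bandlimited_pd (convolve f K)"
  using assms fourier_compact_spectrum_vanishes[of K] unfolding bandlimited_pd_def
  by (metis continuous_on_convolve fourier_convolve integrable_convolve mult_zero_right positive_definite_convolve)

section \<open>The concentrating kernel\<close>

text \<open>An integrable comparison function with polynomial decay in every direction.\<close>

definition decay :: "'a::euclidean_space \<Rightarrow> real" where
  "decay x = (\<Prod>b\<in>Basis. 1 / (1 + (x \<bullet> b)\<^sup>2))"

lemma one_plus_square_pos: "1 + (t::real)\<^sup>2 > 0"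
  by (simp add: add_pos_nonneg)

lemma decay_pos: "decay x > 0"
  by (auto simp: decay_def intro!: prod_pos one_plus_square_pos)

lemma integrable_decay: "integrable lborel (decay :: 'a::euclidean_space \<Rightarrow> real)"
proof -
  have "integrable lborel (\<lambda>x::real. 1 / (1 + x\<^sup>2))"
    using integrable_inverse_1_plus_square by (simp add: set_integrable_def divide_inverse)
  then show ?thesis
    unfolding decay_def[abs_def] by (rule integrable_lborel_prod)
qed

lemma integrable_le_decay:
  fixes F :: "'a::euclidean_space \<Rightarrow> real"
  assumes "F \<in> borel_measurable borel" "\<And>x. \<bar>F x\<bar> \<le> C * decay x"
  shows "integrable lborel F"
proof (rule Bochner_Integration.integrable_bound)
  show "integrable lborel (\<lambda>x::'a. C * decay x)"
    using integrable_decay by (rule integrable_mult_right)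
  show "AE x in lborel. norm (F x) \<le> norm (C * decay x)"
    using order_trans[OF assms(2) abs_ge_self] by auto
qed (use assms(1) in auto)

lemma norm_square_Basis: "(norm (x::'a::euclidean_space))\<^sup>2 = (\<Sum>b\<in>Basis. (x \<bullet> b)\<^sup>2)"
proof -
  have "(norm x)\<^sup>2 = x \<bullet> x" by (rule power2_norm_eq_inner)
  also have "\<dots> = (\<Sum>b\<in>Basis. (x \<bullet> b) * (x \<bullet> b))" by (rule euclidean_inner)
  finally show ?thesis unfolding power2_eq_square .
qed

lemma decay_le: "decay x \<le> 1 / (1 + (norm x)\<^sup>2)"
proof -
  have "1 + (\<Sum>i\<in>I. u i) \<le> (\<Prod>i\<in>I. 1 + u i)" if "finite I" "\<And>i. u i \<ge> 0" for I :: "'a set" and u :: "'a \<Rightarrow> real"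
    using that(1)
  proof (induction I)
    case (insert i I)
    have "1 + (\<Sum>j\<in>insert i I. u j) \<le> (1 + u i) * (1 + (\<Sum>j\<in>I. u j))"
      using insert.hyps that(2) by (simp add: algebra_simps sum_nonneg)
    also have "\<dots> \<le> (1 + u i) * (\<Prod>j\<in>I. 1 + u j)"
      using that(2)[of i] insert.IH by (intro mult_left_mono) auto
    finally show ?case using insert.hyps by simp
  qed simp
  from this[of Basis "\<lambda>b. (x \<bullet> b)\<^sup>2"] have "1 + (norm x)\<^sup>2 \<le> (\<Prod>b\<in>Basis. 1 + (x \<bullet> b)\<^sup>2)"
    by (simp add: norm_square_Basis)
  then show ?thesis
    unfolding decay_def prod_dividef prod.neutral_const
    by (intro divide_left_mono) (auto intro!: mult_pos_pos prod_pos one_plus_square_pos)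
qed

lemma decay_scaleR:
  assumes "\<bar>a\<bar> \<ge> 1" shows "decay (a *\<^sub>R x) \<le> decay x"
  unfolding decay_def
proof (rule prod_mono, intro conjI)
  fix b :: 'a
  have "1 * (x \<bullet> b)\<^sup>2 \<le> a\<^sup>2 * (x \<bullet> b)\<^sup>2"
    using power_mono[OF assms, of 2] by (intro mult_right_mono) auto
  then show "1 / (1 + (a *\<^sub>R x \<bullet> b)\<^sup>2) \<le> 1 / (1 + (x \<bullet> b)\<^sup>2)"
    by (intro divide_left_mono) (auto simp: power_mult_distrib intro!: mult_pos_pos add_pos_nonneg)
qed (simp add: one_plus_square_pos less_imp_le)

lemma one_plus_square_add_le:
  fixes u v :: real
  assumes "v\<^sup>2 \<le> 1"
  shows "1 + (u + v)\<^sup>2 \<le> 3 * (1 + u\<^sup>2)"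
proof -
  have eq: "(u + v)\<^sup>2 = 2 * u\<^sup>2 + 2 * v\<^sup>2 - (u - v)\<^sup>2"
    by (simp add: power2_eq_square algebra_simps)
  have *: "1 + (2 * p + 2 * q - D) \<le> 3 * (1 + p)" if "q \<le> 1" "0 \<le> D" "0 \<le> p" for p q D :: real
    using that by argo
  show ?thesis unfolding eq by (rule *[OF assms]) simp_all
qed

lemma decay_diff_le:
  fixes x y :: "'a::euclidean_space"
  assumes "norm y \<le> 1" shows "decay (x - y) \<le> 3 ^ DIM('a) * decay x"
proof -
  have "decay (x - y) \<le> (\<Prod>b\<in>Basis. 3 * (1 / (1 + (x \<bullet> b)\<^sup>2)))"
    unfolding decay_def
  proof (rule prod_mono, intro conjI)
    fix b :: 'a assume b: "b \<in> Basis"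
    have "(y \<bullet> b)\<^sup>2 \<le> 1"
      using Basis_le_norm[OF b, of y] assms by (simp add: abs_square_le_1)
    then have "1 + ((x - y) \<bullet> b + y \<bullet> b)\<^sup>2 \<le> 3 * (1 + ((x - y) \<bullet> b)\<^sup>2)"
      by (rule one_plus_square_add_le)
    then have "1 + (x \<bullet> b)\<^sup>2 \<le> 3 * (1 + ((x - y) \<bullet> b)\<^sup>2)"
      by (simp add: inner_diff_left)
    then show "1 / (1 + ((x - y) \<bullet> b)\<^sup>2) \<le> 3 * (1 / (1 + (x \<bullet> b)\<^sup>2))"
      using one_plus_square_pos[of "x \<bullet> b"] one_plus_square_pos[of "(x - y) \<bullet> b"]
      by (simp add: divide_simps mult.commute)
  qed (simp add: one_plus_square_pos less_imp_le)
  also have "\<dots> = 3 ^ DIM('a) * decay x"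
    unfolding decay_def prod.distrib by simp
  finally show ?thesis .
qed

text \<open>
  A nonnegative kernel that concentrates at \<open>0\<close> as \<open>a\<close> grows. The exponent is
  \<open>2 + 2 d\<close>, where \<open>d\<close> is the dimension: away from \<open>0\<close> two of the powers are spent on the decay
  \<open>(decay x)\<^sup>2\<close> that the barrier can absorb, and the other \<open>2 d\<close> give a factor
  \<open>a powr (- 4 d)\<close>, which beats the normalisation \<open>a powr d\<close> (\<open>integral_peak_ge\<close>).
\<close>

definition peak :: "real \<Rightarrow> 'a::euclidean_space \<Rightarrow> real" where
  "peak a x = (\<Prod>b\<in>Basis. cosine_window (a * (x \<bullet> b)) ^ (2 * (DIM('a) + 1)))"

lemma compact_spectrum_window_component:
  "compact_spectrum (\<lambda>x. cosine_window (a * (x \<bullet> b)))"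
  using compact_spectrum_cosine_window[of "a *\<^sub>R b"] by (simp add: inner_commute)

lemma compact_spectrum_peak: "compact_spectrum (peak a)"
  unfolding peak_def[abs_def]
  by (intro compact_spectrum_prod compact_spectrum_power compact_spectrum_window_component)

lemma peak_nonneg: "peak a x \<ge> 0"
  unfolding peak_def by (intro prod_nonneg zero_le_even_power) simp_all

lemma peak_le:
  fixes x :: "'a::euclidean_space"
  shows "peak a x \<le> 6 ^ (2 * (DIM('a) + 1) * DIM('a)) * decay (a *\<^sub>R x) ^ (2 * (DIM('a) + 1))"
proof -
  have "peak a x \<le> (\<Prod>b\<in>(Basis :: 'a set). (6 * (1 / (1 + (a *\<^sub>R x \<bullet> b)\<^sup>2))) ^ (2 * (DIM('a) + 1)))"
    unfolding peak_def
  proof (rule prod_mono, intro conjI)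
    fix b :: 'a
    show "0 \<le> cosine_window (a * (x \<bullet> b)) ^ (2 * (DIM('a) + 1))" by (rule zero_le_even_power) simp
    have "\<bar>cosine_window (a * (x \<bullet> b))\<bar> ^ (2 * (DIM('a) + 1)) \<le> (6 * (1 / (1 + (a *\<^sub>R x \<bullet> b)\<^sup>2))) ^ (2 * (DIM('a) + 1))"
      using abs_cosine_window_le[of "a * (x \<bullet> b)"] by (intro power_mono) auto
    then show "cosine_window (a * (x \<bullet> b)) ^ (2 * (DIM('a) + 1)) \<le> (6 * (1 / (1 + (a *\<^sub>R x \<bullet> b)\<^sup>2))) ^ (2 * (DIM('a) + 1))"
      by (simp add: power_even_abs)
  qed
  also have "\<dots> = (6 ^ DIM('a) * decay (a *\<^sub>R x)) ^ (2 * (DIM('a) + 1))"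
    unfolding decay_def prod_power_distrib[symmetric] prod.distrib by simp
  also have "\<dots> = 6 ^ (2 * (DIM('a) + 1) * DIM('a)) * decay (a *\<^sub>R x) ^ (2 * (DIM('a) + 1))"
    by (simp only: power_mult_distrib power_mult[symmetric] mult.commute)
  finally show ?thesis .
qed

lemma decay_le_1: "decay x \<le> 1"
  using decay_le[of x] by (rule order_trans) (simp add: divide_le_eq_1 add_pos_nonneg)

lemma integrable_peak:
  assumes "a \<ge> 1"
  shows "integrable lborel (peak a :: 'a::euclidean_space \<Rightarrow> real)"
proof (rule integrable_le_decay[where C="6 ^ (2 * (DIM('a) + 1) * DIM('a))"])
  show "peak a \<in> borel_measurable (borel :: 'a measure)"
    by (rule compact_spectrum_measurable[OF compact_spectrum_peak])
  fix x :: 'a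
  have "decay (a *\<^sub>R x) ^ (2 * (DIM('a) + 1)) \<le> decay (a *\<^sub>R x) ^ 1"
    using decay_pos[of "a *\<^sub>R x"] decay_le_1[of "a *\<^sub>R x"] by (intro power_decreasing) auto
  also have "\<dots> \<le> decay x" using assms decay_scaleR[of a x] by simp
  finally have "6 ^ (2 * (DIM('a) + 1) * DIM('a)) * decay (a *\<^sub>R x) ^ (2 * (DIM('a) + 1)) \<le>
      6 ^ (2 * (DIM('a) + 1) * DIM('a)) * decay x"
    by (intro mult_left_mono) auto
  with peak_le[of a x] show "\<bar>peak a x\<bar> \<le> 6 ^ (2 * (DIM('a) + 1) * DIM('a)) * decay x"
    using peak_nonneg[of a x] by linarith
qed

lemma integral_peak_ge:
  assumes a: "a \<ge> 1"
  shows "(LINT x|lborel. peak a (x :: 'a::euclidean_space)) \<ge> (1 / a) ^ DIM('a)"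
proof -
  let ?Q = "cube (1 / a) :: 'a set"
  have "(1 / a) ^ DIM('a) = measure lborel ?Q"
    using a by (subst measure_lborel_cbox_eq) auto
  also have "\<dots> = (LINT x|lborel. indicator ?Q x)" by simp
  also have "\<dots> \<le> (LINT x|lborel. peak a (x::'a))"
  proof (rule Bochner_Integration.integral_mono)
    show "integrable lborel (indicator ?Q :: 'a \<Rightarrow> real)" by (rule integrable_indicator_cbox)
    show "integrable lborel (peak a :: 'a \<Rightarrow> real)" by (rule integrable_peak[OF a])
    show "indicator ?Q x \<le> peak a x" for x :: 'a
    proof (cases "x \<in> ?Q")
      case True
      have "1 \<le> peak a x"
        unfolding peak_def
      proof (rule prod_ge_1)
        fix b :: 'a assume b: "b \<in> Basis"
        have "0 \<le> x \<bullet> b" "x \<bullet> b \<le> 1 / a" using True b by (auto simp: mem_box)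
        then have "\<bar>a * (x \<bullet> b)\<bar> \<le> 1" using a by (simp add: abs_mult field_simps)
        from cosine_window_ge_1[OF this] show "1 \<le> cosine_window (a * (x \<bullet> b)) ^ (2 * (DIM('a) + 1))"
          by (rule one_le_power)
      qed
      then show ?thesis using True by simp
    qed (simp add: peak_nonneg)
  qed
  finally show ?thesis .
qed

lemma peak_far_le:
  fixes x y :: "'a::euclidean_space"
  assumes a: "a \<ge> 1" and y: "norm y \<le> 1" and \<rho>: "\<rho> > 0" "\<rho> \<le> norm (x - y)"
  shows "peak a (x - y) \<le> 6 ^ (2 * (DIM('a) + 1) * DIM('a)) * 9 ^ DIM('a) * (decay x)\<^sup>2 / (a * \<rho>) ^ (4 * DIM('a))"
proof -
  let ?z = "x - y" and ?A = "6 ^ (2 * (DIM('a) + 1) * DIM('a)) :: real"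
  have "(decay (a *\<^sub>R ?z))\<^sup>2 \<le> (3 ^ DIM('a) * decay x)\<^sup>2"
    using decay_scaleR[of a ?z] decay_diff_le[OF y, of x] decay_pos[of "a *\<^sub>R ?z"] a
    by (intro power_mono) auto
  also have "\<dots> = 9 ^ DIM('a) * (decay x)\<^sup>2"
    by (simp add: power2_eq_square mult_ac flip: power_mult_distrib)
  finally have 1: "(decay (a *\<^sub>R ?z))\<^sup>2 \<le> 9 ^ DIM('a) * (decay x)\<^sup>2" .
  have "decay (a *\<^sub>R ?z) \<le> 1 / (a * \<rho>)\<^sup>2"
  proof (rule order_trans[OF decay_le])
    have "(a * \<rho>)\<^sup>2 \<le> (norm (a *\<^sub>R ?z))\<^sup>2"
      using a \<rho> by (intro power_mono) (auto intro: mult_left_mono)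
    then have "(a * \<rho>)\<^sup>2 \<le> 1 + (norm (a *\<^sub>R ?z))\<^sup>2" by linarith
    then show "1 / (1 + (norm (a *\<^sub>R ?z))\<^sup>2) \<le> 1 / (a * \<rho>)\<^sup>2"
      using a \<rho> by (intro divide_left_mono) (auto intro!: mult_pos_pos add_pos_nonneg)
  qed
  then have "decay (a *\<^sub>R ?z) ^ (2 * DIM('a)) \<le> (1 / (a * \<rho>)\<^sup>2) ^ (2 * DIM('a))"
    using decay_pos[of "a *\<^sub>R ?z"] by (intro power_mono) auto
  also have "\<dots> = 1 / (a * \<rho>) ^ (4 * DIM('a))"
    by (simp add: power_divide power_mult[symmetric])
  finally have 2: "decay (a *\<^sub>R ?z) ^ (2 * DIM('a)) \<le> 1 / (a * \<rho>) ^ (4 * DIM('a))" .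
  have "peak a ?z \<le> ?A * ((decay (a *\<^sub>R ?z))\<^sup>2 * decay (a *\<^sub>R ?z) ^ (2 * DIM('a)))"
    using peak_le[of a ?z] by (simp add: power_add[symmetric])
  also have "\<dots> \<le> ?A * ((9 ^ DIM('a) * (decay x)\<^sup>2) * (1 / (a * \<rho>) ^ (4 * DIM('a))))"
    using decay_pos[of "a *\<^sub>R ?z"] by (intro mult_left_mono mult_mono 1 2) auto
  finally show ?thesis by simp
qed

section \<open>The barrier function\<close>

text \<open>
  Up to the factor \<open>1/2\<close> this is \<open>1 - (c\<^sub>i x\<^sub>i)\<^sup>2\<close> times a product of squared windows
  (\<open>barrier_term_eq\<close>); in the form below each factor visibly has compact spectrum.
\<close>

definition barrier_term :: "('a \<Rightarrow> real) \<Rightarrow> 'a \<Rightarrow> 'a::euclidean_space \<Rightarrow> real" where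
  "barrier_term c i x = (\<Prod>b\<in>Basis. if b = i
     then cos (c b * (x \<bullet> b) * (pi / 2)) * cosine_window (c b * (x \<bullet> b))
     else (cosine_window (c b * (x \<bullet> b)))\<^sup>2)"

lemma barrier_term_eq:
  assumes i: "i \<in> Basis"
  shows "barrier_term c i x = (1 - (c i * (x \<bullet> i))\<^sup>2) / 2 * (\<Prod>b\<in>Basis. (cosine_window (c b * (x \<bullet> b)))\<^sup>2)"
proof -
  let ?V = "\<lambda>b. cosine_window (c b * (x \<bullet> b))"
  have "cos (c i * (x \<bullet> i) * (pi / 2)) = (1 - (c i * (x \<bullet> i))\<^sup>2) / 2 * ?V i"
    using cosine_window_eq[of "c i * (x \<bullet> i)"] by simp
  then show ?thesis
    unfolding barrier_term_def using i
    by (simp add: prod.remove[OF finite_Basis i] power2_eq_square)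
qed

lemma bandlimited_pd_barrier_term:
  assumes c: "\<And>b. c b \<ge> 1"
  shows "bandlimited_pd (barrier_term c i)"
proof (rule bandlimited_pd_compact_spectrum)
  have cs: "compact_spectrum (\<lambda>x::'a. cos (c b * (x \<bullet> b) * (pi / 2)))" for b
    using compact_spectrum_cos[of "(c b * (pi / 2)) *\<^sub>R b"] by (simp add: inner_commute mult_ac)
  show *: "compact_spectrum (barrier_term c i)"
    unfolding barrier_term_def[abs_def]
  proof (rule compact_spectrum_prod)
    fix b :: 'a
    show "compact_spectrum (\<lambda>x. if b = i then cos (c b * (x \<bullet> b) * (pi / 2)) * cosine_window (c b * (x \<bullet> b))
       else (cosine_window (c b * (x \<bullet> b)))\<^sup>2)"
      by (cases "b = i", simp_all only: if_True if_False simp_thms)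
         (intro compact_spectrum_mult compact_spectrum_power compact_spectrum_window_component cs)+
  qed
  show "integrable lborel (barrier_term c i)"
  proof (rule integrable_le_decay[where C="12 ^ DIM('a)"])
    show "barrier_term c i \<in> borel_measurable borel"
      by (rule compact_spectrum_measurable[OF *])
    fix x :: 'a
    have "\<bar>barrier_term c i x\<bar> \<le> (\<Prod>b\<in>(Basis::'a set). 12 * (1 / (1 + (x \<bullet> b)\<^sup>2)))"
      unfolding barrier_term_def abs_prod
    proof (rule prod_mono, intro conjI)
      fix b :: 'a
      let ?u = "c b * (x \<bullet> b)"
      have "1 * (x \<bullet> b)\<^sup>2 \<le> (c b)\<^sup>2 * (x \<bullet> b)\<^sup>2"
        using power_mono[OF c, of 2 b] by (intro mult_right_mono) auto
      then have "6 / (1 + ?u\<^sup>2) \<le> 6 / (1 + (x \<bullet> b)\<^sup>2)"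
        by (intro divide_left_mono) (auto simp: power_mult_distrib intro!: mult_pos_pos add_pos_nonneg)
      with abs_cosine_window_le[of ?u] have V: "\<bar>cosine_window ?u\<bar> \<le> 6 / (1 + (x \<bullet> b)\<^sup>2)" by linarith
      have "\<bar>cos (?u * (pi / 2))\<bar> * \<bar>cosine_window ?u\<bar> \<le> 2 * (6 / (1 + (x \<bullet> b)\<^sup>2))"
        using order_trans[OF abs_cos_le_one[of "?u * (pi / 2)"], of 2] V by (intro mult_mono) simp_all
      moreover have "\<bar>cosine_window ?u\<bar> * \<bar>cosine_window ?u\<bar> \<le> 2 * (6 / (1 + (x \<bullet> b)\<^sup>2))"
        using abs_cosine_window_le_2 V by (intro mult_mono) auto
      ultimately show "\<bar>if b = i then cos (?u * (pi / 2)) * cosine_window ?u else (cosine_window ?u)\<^sup>2\<bar>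
          \<le> 12 * (1 / (1 + (x \<bullet> b)\<^sup>2))"
        by (auto simp: abs_mult power2_eq_square)
    qed simp
    also have "\<dots> = 12 ^ DIM('a) * decay x"
      unfolding decay_def prod.distrib by simp
    finally show "\<bar>barrier_term c i x\<bar> \<le> 12 ^ DIM('a) * decay x" .
  qed
qed

text \<open>
  With \<open>d\<close> the dimension, the sum over \<open>i\<close> produces the factor \<open>d - \<Sum>\<^sub>i (c\<^sub>i x\<^sub>i)\<^sup>2\<close>. Since \<open>c\<^sub>i\<^sup>2 \<ge> 8 d\<close>, it is at
  most \<open>- d\<close> for \<open>\<bar>x\<bar> \<ge> 1/2\<close>. The sum over all \<open>\<sigma>\<close> with values in \<open>{1, 2}\<close>
  expands a product over the coordinates of sums of two squared windows, which removes the zeros. The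
  maximum with \<open>1\<close> is only effective off the basis, where \<open>\<sigma>\<close> is \<open>undefined\<close>.
\<close>

definition barrier :: "'a::euclidean_space \<Rightarrow> real" where
  "barrier x = (\<Sum>\<sigma>\<in>PiE Basis (\<lambda>_. {1, 2}). \<Sum>i\<in>Basis. barrier_term (\<lambda>b. max 1 (\<sigma> b) * sqrt (8 * DIM('a))) i x)"

lemma bandlimited_pd_barrier: "bandlimited_pd (barrier :: 'a::euclidean_space \<Rightarrow> real)"
  unfolding barrier_def[abs_def]
proof (intro bandlimited_pd_sum bandlimited_pd_barrier_term)
  fix \<sigma> :: "'a \<Rightarrow> real" and b
  have "1 \<le> real DIM('a)" using DIM_positive[where 'a='a] by linarith
  then have "1\<^sup>2 \<le> real (8 * DIM('a))" unfolding of_nat_mult of_nat_numeral one_power2 by argo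
  then have "1 \<le> sqrt (8 * DIM('a))" by (rule real_le_rsqrt)
  then have "1 * 1 \<le> max 1 (\<sigma> b) * sqrt (8 * DIM('a))" by (intro mult_mono) auto
  then show "1 \<le> max 1 (\<sigma> b) * sqrt (8 * DIM('a))" by simp
qed

lemma barrier_0_pos: "barrier 0 > 0"
proof -
  have "barrier_term c i (0 :: 'a) > 0" for c i
    unfolding barrier_term_def by (intro prod_pos) (auto simp: cosine_window_0)
  moreover have "PiE (Basis :: 'a set) (\<lambda>_. {1, 2 :: real}) \<noteq> {}" by (simp add: PiE_eq_empty_iff)
  ultimately show ?thesis
    unfolding barrier_def by (intro sum_pos) (auto intro!: finite_PiE)
qed

lemma barrier_le:
  fixes x :: "'a::euclidean_space"
  assumes x: "norm x \<ge> 1 / 2"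
  shows "barrier x \<le> - (real DIM('a) / 2 * ((7 / 4) / (32 * real DIM('a))\<^sup>2) ^ DIM('a)) * (decay x)\<^sup>2"
proof -
  let ?d = "real DIM('a)" and ?l = "sqrt (8 * DIM('a))" and ?V = cosine_window
  have d: "?d \<ge> 1" using DIM_positive[where 'a='a] by linarith
  have l2: "?l\<^sup>2 = 8 * ?d" by simp
  define P where "P \<sigma> = (\<Prod>b\<in>Basis. (?V (\<sigma> b * (?l * (x \<bullet> b))))\<^sup>2)" for \<sigma> :: "'a \<Rightarrow> real"
  have term_le: "(\<Sum>i\<in>Basis. barrier_term (\<lambda>b. max 1 (\<sigma> b) * ?l) i x) \<le> - (?d / 2) * P \<sigma>"
    if \<sigma>: "\<sigma> \<in> PiE Basis (\<lambda>_. {1, 2})" for \<sigma> :: "'a \<Rightarrow> real"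
  proof -
    have \<sigma>1: "1 \<le> \<sigma> b" if "b \<in> Basis" for b using \<sigma> that by (auto simp: PiE_iff)
    have Peq: "(\<Prod>b\<in>Basis. (?V (max 1 (\<sigma> b) * ?l * (x \<bullet> b)))\<^sup>2) = P \<sigma>"
      unfolding P_def using \<sigma>1 by (intro prod.cong) (auto simp: max_def mult.assoc)
    have P0: "P \<sigma> \<ge> 0" unfolding P_def by (intro prod_nonneg) auto
    have "(\<Sum>i\<in>Basis. barrier_term (\<lambda>b. max 1 (\<sigma> b) * ?l) i x) \<le> (\<Sum>i\<in>Basis. (1 - ?l\<^sup>2 * (x \<bullet> i)\<^sup>2) / 2 * P \<sigma>)"
    proof (rule sum_mono)
      fix i :: 'a assume i: "i \<in> Basis"
      have "1 * (?l * (x \<bullet> i))\<^sup>2 \<le> (max 1 (\<sigma> i))\<^sup>2 * (?l * (x \<bullet> i))\<^sup>2"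
        by (intro mult_right_mono) (auto simp: one_le_power)
      then have "?l\<^sup>2 * (x \<bullet> i)\<^sup>2 \<le> (max 1 (\<sigma> i) * ?l * (x \<bullet> i))\<^sup>2"
        by (simp only: power_mult_distrib mult.assoc mult_1)
      then show "barrier_term (\<lambda>b. max 1 (\<sigma> b) * ?l) i x \<le> (1 - ?l\<^sup>2 * (x \<bullet> i)\<^sup>2) / 2 * P \<sigma>"
        unfolding barrier_term_eq[OF i] Peq using P0 by (intro mult_right_mono) auto
    qed
    also have "\<dots> = (?d - 8 * ?d * (norm x)\<^sup>2) / 2 * P \<sigma>"
      unfolding l2
      by (simp add: sum_distrib_right[symmetric] sum_divide_distrib[symmetric] sum_subtractf
          sum_distrib_left[symmetric] norm_square_Basis)
    also have "\<dots> \<le> - (?d / 2) * P \<sigma>"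
    proof (rule mult_right_mono[OF _ P0])
      have "8 * ?d * (1 / 2)\<^sup>2 \<le> 8 * ?d * (norm x)\<^sup>2"
        using x d by (intro mult_left_mono power_mono) auto
      then show "(?d - 8 * ?d * (norm x)\<^sup>2) / 2 \<le> - (?d / 2)" by (simp add: power2_eq_square)
    qed
    finally show ?thesis .
  qed
  have "barrier x \<le> (\<Sum>\<sigma>\<in>PiE Basis (\<lambda>_. {1, 2}). - (?d / 2) * P \<sigma>)"
    unfolding barrier_def by (rule sum_mono[OF term_le])
  also have "\<dots> = - (?d / 2) * (\<Sum>\<sigma>\<in>PiE Basis (\<lambda>_. {1, 2}). P \<sigma>)"
    by (simp add: sum_distrib_left)
  also have "(\<Sum>\<sigma>\<in>PiE Basis (\<lambda>_. {1, 2}). P \<sigma>) = (\<Prod>b\<in>Basis. \<Sum>s\<in>{1, 2}. (?V (s * (?l * (x \<bullet> b))))\<^sup>2)"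
    unfolding P_def by (rule prod_sum_PiE[symmetric]) auto
  also have "- (?d / 2) * \<dots> \<le> - (?d / 2) * (\<Prod>b\<in>(Basis :: 'a set). (7 / 4) / (32 * ?d)\<^sup>2 * (1 / (1 + (x \<bullet> b)\<^sup>2))\<^sup>2)"
  proof (rule mult_left_mono_neg)
    show "(\<Prod>b\<in>(Basis :: 'a set). (7 / 4) / (32 * ?d)\<^sup>2 * (1 / (1 + (x \<bullet> b)\<^sup>2))\<^sup>2) \<le> (\<Prod>b\<in>Basis. \<Sum>s\<in>{1, 2}. (?V (s * (?l * (x \<bullet> b))))\<^sup>2)"
    proof (rule prod_mono, intro conjI)
      fix b :: 'a
      let ?t = "x \<bullet> b"
      have "1 + 4 * (?l * ?t)\<^sup>2 = 1 + 32 * ?d * ?t\<^sup>2"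
        by (simp add: power_mult_distrib)
      also have "\<dots> \<le> 32 * ?d + 32 * ?d * ?t\<^sup>2" using d by argo
      finally have "1 + 4 * (?l * ?t)\<^sup>2 \<le> 32 * ?d * (1 + ?t\<^sup>2)" by (simp add: distrib_left)
      then have "(1 + 4 * (?l * ?t)\<^sup>2)\<^sup>2 \<le> (32 * ?d * (1 + ?t\<^sup>2))\<^sup>2"
        by (intro power_mono) auto
      then have "(7 / 4) / (32 * ?d * (1 + ?t\<^sup>2))\<^sup>2 \<le> (7 / 4) / (1 + 4 * (?l * ?t)\<^sup>2)\<^sup>2"
        using d one_plus_square_pos[of ?t]
        by (intro divide_left_mono mult_pos_pos zero_less_power) (auto intro: add_pos_nonneg)
      also have "\<dots> \<le> (\<Sum>s\<in>{1, 2}. (?V (s * (?l * ?t)))\<^sup>2)"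
        using cosine_window_squares[of "?l * ?t"] by simp
      finally show "(7 / 4) / (32 * ?d)\<^sup>2 * (1 / (1 + ?t\<^sup>2))\<^sup>2 \<le> (\<Sum>s\<in>{1, 2}. (?V (s * (?l * ?t)))\<^sup>2)"
        by (simp add: power_mult_distrib power_divide)
    qed simp
  qed simp
  also have "(\<Prod>b\<in>(Basis :: 'a set). (7 / 4) / (32 * ?d)\<^sup>2 * (1 / (1 + (x \<bullet> b)\<^sup>2))\<^sup>2) = ((7 / 4) / (32 * ?d)\<^sup>2) ^ DIM('a) * (decay x)\<^sup>2"
    unfolding decay_def prod_power_distrib prod.distrib by simp
  finally show ?thesis by (simp add: mult.assoc)
qed

section \<open>Bandlimited perturbation of compactly supported functions\<close>

lemma convolve_peak_far_le:
  fixes f :: "'a::euclidean_space \<Rightarrow> real"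
  assumes f: "integrable lborel f" "\<And>y. f y \<le> 1" "\<And>y. norm y > r \<Longrightarrow> f y \<le> 0"
    and r: "r \<le> 1" and a: "a \<ge> 1" and \<rho>: "\<rho> > 0" and x: "norm x \<ge> r + \<rho>"
  shows "convolve f (peak a) x \<le>
    measure lborel (cball (0::'a) 1) * (6 ^ (2 * (DIM('a) + 1) * DIM('a)) * 9 ^ DIM('a) * (decay x)\<^sup>2 / (a * \<rho>) ^ (4 * DIM('a)))"
    (is "_ \<le> _ * ?D")
proof -
  have [measurable]: "f \<in> borel_measurable borel" using f(1) by auto
  note [measurable] = compact_spectrum_measurable[OF compact_spectrum_peak]
  have D: "?D \<ge> 0" using a \<rho> by auto
  have "convolve f (peak a) x \<le> (LINT y|lborel. indicator (cball (0::'a) 1) y * ?D)"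
    unfolding convolve_def
  proof (rule Bochner_Integration.integral_mono)
    have "integrable lborel (\<lambda>y. f y * peak a (0::'a))" using f(1) by simp
    then show "integrable lborel (\<lambda>y. f y * peak a (x - y))"
    proof (rule Bochner_Integration.integrable_bound)
      have "\<bar>f y\<bar> * \<bar>peak a (x - y)\<bar> \<le> \<bar>f y\<bar> * \<bar>peak a (0::'a)\<bar>" for y
        using compact_spectrum_abs_le[OF compact_spectrum_peak, of a "x - y"]
        by (intro mult_left_mono) auto
      then show "AE y in lborel. norm (f y * peak a (x - y)) \<le> norm (f y * peak a (0::'a))"
        by (simp add: abs_mult)
    qed measurable
    show "integrable lborel (\<lambda>y::'a. indicator (cball 0 1) y * ?D)"
      by (intro integrable_mult_left integrable_real_indicator emeasure_lborel_cball_finite) auto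
    fix y :: 'a
    show "f y * peak a (x - y) \<le> indicator (cball 0 1) y * ?D"
    proof (cases "norm y \<le> r")
      case True
      then have y1: "norm y \<le> 1" using r by linarith
      have "\<rho> \<le> norm (x - y)" using norm_triangle_ineq2[of x y] x True by linarith
      from peak_far_le[OF a y1 \<rho> this] have "peak a (x - y) \<le> ?D" .
      moreover have "f y * peak a (x - y) \<le> 1 * peak a (x - y)"
        by (intro mult_right_mono f(2) peak_nonneg)
      ultimately show ?thesis using y1 by simp
    next
      case False
      then have "f y * peak a (x - y) \<le> 0"
        using f(3)[of y] by (intro mult_nonpos_nonneg peak_nonneg) auto
      also have "0 \<le> indicator (cball 0 1) y * ?D" using D by (intro mult_nonneg_nonneg) simp_all
      finally show ?thesis .
    qed
  qed
  also have "\<dots> = measure lborel (cball (0::'a) 1) * ?D"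
    by (subst integral_mult_left_zero) simp
  finally show ?thesis .
qed

lemma bandlimited_pd_in_class:
  fixes F :: "'a::euclidean_space \<Rightarrow> real"
  assumes F: "bandlimited_pd F" and F0: "F 0 > 0" and r: "r < 1"
    and neg: "\<And>x. norm x \<ge> r \<Longrightarrow> F x \<le> 0"
  shows "(\<lambda>x. F x / F 0) \<in> bandlimited_delsarte_class (ball 0 1)"
proof -
  let ?H = "\<lambda>x. (1 / F 0) * F x"
  have H: "bandlimited_pd ?H" using F F0 by (intro bandlimited_pd_scale) auto
  then obtain R where R: "\<And>s. norm s > R \<Longrightarrow> fourier ?H s = 0"
    unfolding bandlimited_pd_def by blast
  have "{s. fourier ?H s \<noteq> 0} \<subseteq> cball 0 R"
    using R by (auto simp: not_less[symmetric])
  then have "bounded (supp (fourier ?H))"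
    unfolding supp_def by (metis bounded_cball bounded_closure bounded_subset)
  then have cpt: "compact (supp (fourier ?H))"
    by (simp add: supp_def compact_eq_bounded_closed)
  have "{x. pos_part ?H x \<noteq> 0} \<subseteq> cball 0 r"
  proof
    fix x assume "x \<in> {x. pos_part ?H x \<noteq> 0}"
    then have "?H x > 0" by (auto simp: pos_part_def max_def split: if_splits)
    then have "F x > 0" using F0 by (simp add: zero_less_divide_iff)
    then show "x \<in> cball 0 r" using neg[of x] by (cases "norm x \<ge> r") auto
  qed
  then have "supp (pos_part ?H) \<subseteq> cball 0 r"
    unfolding supp_def by (intro closure_minimal) auto
  then have supp: "supp (pos_part ?H) \<subseteq> ball 0 1" using r by auto
  have "?H \<in> bandlimited_delsarte_class (ball 0 1)"
    using H F0 cpt supp unfolding bandlimited_delsarte_class_def bandlimited_pd_def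
    by (simp only: mem_Collect_eq) simp
  then show ?thesis by (simp add: divide_inverse mult.commute)
qed

lemma in_supp: "f x \<noteq> 0 \<Longrightarrow> x \<in> supp f"
  unfolding supp_def by (rule closure_subset[THEN subsetD]) simp

lemma delsarte_class_integrable:
  fixes f :: "'a::euclidean_space \<Rightarrow> real"
  assumes "f \<in> delsarte_class B"
  shows "integrable lborel f"
proof -
  let ?S = "supp (pos_part f) \<union> supp (neg_part f)"
  have "compact ?S" and cont: "continuous_on UNIV f"
    using assms by (auto simp: delsarte_class_def intro!: compact_Un)
  then have "integrable lborel (\<lambda>x. indicator ?S x *\<^sub>R f x)"
    by (intro borel_integrable_compact) (auto intro: continuous_on_subset)
  moreover have "(\<lambda>x. indicator ?S x *\<^sub>R f x) = f"
  proof
    fix x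
    have "x \<in> ?S" if "f x \<noteq> 0"
    proof (cases "f x > 0")
      case True
      then have "x \<in> supp (pos_part f)" by (intro in_supp) (simp add: pos_part_def)
      then show ?thesis by simp
    next
      case False
      then have "x \<in> supp (neg_part f)" using that by (intro in_supp) (simp add: neg_part_def)
      then show ?thesis by simp
    qed
    then show "indicator ?S x *\<^sub>R f x = f x" by (cases "x \<in> ?S") auto
  qed
  ultimately show ?thesis by simp
qed

text \<open>The positive part lives in a ball of radius strictly below \<open>1\<close>, because its support is compact.\<close>

lemma delsarte_class_radius:
  fixes f :: "'a::euclidean_space \<Rightarrow> real"
  assumes "f \<in> delsarte_class (ball 0 1)"
  obtains r where "0 \<le> r" "r < 1" "\<And>x. norm x > r \<Longrightarrow> f x \<le> 0"
proof -
  let ?S = "supp (pos_part f)"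
  have cpt: "compact ?S" and sub: "?S \<subseteq> ball 0 1" and f0: "f 0 = 1"
    using assms by (auto simp: delsarte_class_def)
  have S: "x \<in> ?S" if "f x > 0" for x
    using that by (intro in_supp) (simp add: pos_part_def)
  have "?S \<noteq> {}" using S[of 0] f0 by auto
  then obtain z where z: "z \<in> ?S" "\<And>x. x \<in> ?S \<Longrightarrow> norm x \<le> norm z"
    using continuous_attains_sup[OF cpt, of norm] by (auto intro: continuous_intros)
  show ?thesis
  proof (rule that)
    show "norm z < 1" using z(1) sub by auto
    show "f x \<le> 0" if "norm x > norm z" for x
      using S[of x] z(2)[of x] that by (cases "f x > 0") auto
  qed simp
qed

text \<open>
  The function \<open>(f * peak a) / I + \<eta> barrier\<close>, with \<open>I\<close> the integral of the kernel and \<open>a\<close> large in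
  terms of \<open>\<eta>\<close>, is a positive multiple of a member of the bandlimited class. Its integral is
  nonnegative, so dividing by the upper bound \<open>1 + \<eta> barrier 0\<close> instead of the value at \<open>0\<close> only
  decreases the quotient.
\<close>

lemma bandlimited_perturbation_bound:
  fixes f :: "'a::euclidean_space \<Rightarrow> real"
  assumes f: "f \<in> delsarte_class (ball 0 1)" and \<eta>: "\<eta> > 0"
  shows "ereal (((LINT x|lborel. f x) + \<eta> * (LINT x|lborel. barrier (x::'a))) / (1 + \<eta> * barrier (0::'a)))
    \<le> bandlimited_delsarte_const (ball (0::'a) 1)"
proof -
  have cont: "continuous_on UNIV f" and pd: "positive_definite f" and f0: "f 0 = 1"
    using f by (auto simp: delsarte_class_def)
  have int: "integrable lborel f" by (rule delsarte_class_integrable[OF f])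
  obtain r where r: "0 \<le> r" "r < 1" and neg: "\<And>x. norm x > r \<Longrightarrow> f x \<le> 0"
    using delsarte_class_radius[OF f] by blast
  have f1: "\<bar>f y\<bar> \<le> 1" for y using positive_definite_abs_le[OF pd, of y] f0 by simp
  define \<rho> where "\<rho> = (1 - r) / 2"
  have \<rho>: "\<rho> > 0" using r by (simp add: \<rho>_def)
  define C where "C = measure lborel (cball (0::'a) 1) * (6 ^ (2 * (DIM('a) + 1) * DIM('a)) * 9 ^ DIM('a)) / \<rho> ^ (4 * DIM('a))"
  define c where "c = real DIM('a) / 2 * ((7 / 4) / (32 * real DIM('a))\<^sup>2) ^ DIM('a)"
  have c: "c > 0" by (simp add: c_def)
  have C: "C \<ge> 0" using \<rho> by (simp add: C_def)
  \<comment> \<open>the normalised tail of the kernel is at most \<open>(C / a) (decay x)\<^sup>2\<close>\<close>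
  define a where "a = max 1 (C / (\<eta> * c))"
  have a: "a \<ge> 1" and aC: "C / a \<le> \<eta> * c"
    using c \<eta> by (auto simp: a_def max_def field_simps)
  define I where "I = (LINT x|lborel. peak a (x :: 'a))"
  have I: "I \<ge> (1 / a) ^ DIM('a)" unfolding I_def by (rule integral_peak_ge[OF a])
  have Ia: "(1 / a) ^ DIM('a) > 0" using a by simp
  have Ipos: "I > 0" using I Ia by linarith
  define F where "F x = (1 / I) * convolve f (peak a) x + \<eta> * barrier x" for x
  have bconv: "bandlimited_pd (convolve f (peak a))"
    by (intro bandlimited_pd_convolve cont pd int compact_spectrum_peak integrable_peak a)
  have bF: "bandlimited_pd F"
    unfolding F_def[abs_def]
    using Ipos \<eta> by (intro bandlimited_pd_add bandlimited_pd_scale bandlimited_pd_barrier bconv) auto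
  have Fint: "integrable lborel F" and Fpd: "positive_definite F" and Fcont: "continuous_on UNIV F"
    using bF by (auto simp: bandlimited_pd_def)
  have conv0: "0 \<le> convolve f (peak a) 0" "convolve f (peak a) 0 \<le> I"
  proof -
    show "0 \<le> convolve f (peak a) 0"
      using bconv by (auto simp: bandlimited_pd_def intro: positive_definite_zero_nonneg)
    have "(LINT y|lborel. f y * peak a (0 - y)) \<le> (LINT y|lborel. peak a (0 - y::'a))"
    proof (rule Bochner_Integration.integral_mono)
      show i: "integrable lborel (\<lambda>y::'a. peak a (0 - y))"
        by (intro lborel_integrable_diff integrable_peak a)
      have [measurable]: "f \<in> borel_measurable borel" using int by auto
      note [measurable] = compact_spectrum_measurable[OF compact_spectrum_peak]
      have "\<bar>f y\<bar> * peak a (0 - y) \<le> 1 * peak a (0 - y)" for y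
        by (intro mult_right_mono f1 peak_nonneg)
      then have "norm (f y * peak a (0 - y)) \<le> norm (peak a (0 - y))" for y
        by (simp only: real_norm_def abs_mult abs_of_nonneg[OF peak_nonneg] mult_1)
      then show "integrable lborel (\<lambda>y. f y * peak a (0 - y))"
        by (intro Bochner_Integration.integrable_bound[OF i] AE_I2) measurable
      show "f y * peak a (0 - y) \<le> peak a (0 - y)" for y
        using mult_right_mono[OF order_trans[OF abs_ge_self f1[of y]] peak_nonneg[of a "0 - y"]] by simp
    qed
    also have "\<dots> = I"
      unfolding I_def by (intro lborel_integral_diff compact_spectrum_measurable compact_spectrum_peak)
    finally show "convolve f (peak a) 0 \<le> I" by (simp add: convolve_def)
  qed
  have F0: "F 0 > 0" "F 0 \<le> 1 + \<eta> * barrier (0::'a)"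
  proof -
    have "\<eta> * barrier (0::'a) > 0" using \<eta> barrier_0_pos by (rule mult_pos_pos)
    moreover have "0 \<le> (1 / I) * convolve f (peak a) 0" "(1 / I) * convolve f (peak a) 0 \<le> 1"
      using conv0 Ipos by simp_all
    ultimately show "F 0 > 0" "F 0 \<le> 1 + \<eta> * barrier (0::'a)" by (simp_all add: F_def)
  qed
  have Fneg: "F x \<le> 0" if x: "norm x \<ge> r + \<rho>" for x
  proof -
    have "convolve f (peak a) x \<le> C / a ^ (4 * DIM('a)) * (decay x)\<^sup>2"
      using convolve_peak_far_le[OF int order_trans[OF abs_ge_self f1] neg less_imp_le[OF r(2)] a \<rho> x]
      by (simp add: C_def power_mult_distrib field_simps)
    then have "(1 / I) * convolve f (peak a) x \<le> (1 / I) * (C / a ^ (4 * DIM('a)) * (decay x)\<^sup>2)"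
      using Ipos by (intro mult_left_mono) auto
    also have "\<dots> \<le> a ^ DIM('a) * (C / a ^ (4 * DIM('a)) * (decay x)\<^sup>2)"
    proof (rule mult_right_mono)
      have "1 / I \<le> 1 / (1 / a) ^ DIM('a)"
        using I Ia Ipos by (intro divide_left_mono) auto
      then show "1 / I \<le> a ^ DIM('a)" by (simp add: power_divide)
    qed (use C a in auto)
    also have "\<dots> = (C * (1 / a ^ (3 * DIM('a)))) * (decay x)\<^sup>2"
    proof -
      have "a ^ (4 * DIM('a)) = a ^ DIM('a) * a ^ (3 * DIM('a))" by (simp add: power_add[symmetric])
      then show ?thesis using a by simp
    qed
    also have "\<dots> \<le> (C * (1 / a)) * (decay x)\<^sup>2"
    proof (intro mult_right_mono mult_left_mono divide_left_mono)
      have "a ^ 1 \<le> a ^ (3 * DIM('a))" using a DIM_positive[where 'a='a] by (intro power_increasing) auto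
      then show "a \<le> a ^ (3 * DIM('a))" by simp
    qed (use C a in auto)
    also have "\<dots> \<le> (\<eta> * c) * (decay x)\<^sup>2"
      using aC by (intro mult_right_mono) auto
    finally have 1: "(1 / I) * convolve f (peak a) x \<le> (\<eta> * c) * (decay x)\<^sup>2" .
    have "norm x \<ge> 1 / 2" using x r by (simp add: \<rho>_def field_simps)
    from barrier_le[OF this] have "\<eta> * barrier x \<le> \<eta> * (- c * (decay x)\<^sup>2)"
      using \<eta> by (intro mult_left_mono) (auto simp: c_def)
    with 1 show ?thesis by (simp add: F_def mult.assoc)
  qed
  have "r + \<rho> < 1" using r by (simp add: \<rho>_def field_simps)
  from bandlimited_pd_in_class[OF bF F0(1) this Fneg]
  have "ereal (LINT x|lborel. F x / F 0) \<le> bandlimited_delsarte_const (ball (0::'a) 1)"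
    unfolding bandlimited_delsarte_const_def by (rule SUP_upper)
  moreover have "(LINT x|lborel. F x) = (LINT x|lborel. f x) + \<eta> * (LINT x|lborel. barrier (x::'a))"
  proof -
    \<comment> \<open>the convolution theorem at frequency \<open>0\<close>\<close>
    have "complex_of_real (LINT x|lborel. convolve f (peak a) x) = complex_of_real ((LINT x|lborel. f x) * I)"
      using fourier_convolve[OF int integrable_peak[OF a], of 0] by (simp add: fourier_0 I_def)
    then have "(LINT x|lborel. convolve f (peak a) x) = (LINT x|lborel. f x) * I"
      by (simp only: of_real_eq_iff)
    moreover have "(LINT x|lborel. F x) = (1 / I) * (LINT x|lborel. convolve f (peak a) x) + \<eta> * (LINT x|lborel. barrier (x::'a))"
      unfolding F_def using bconv bandlimited_pd_barrier[where 'a='a]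
      by (simp add: bandlimited_pd_def)
    ultimately show ?thesis using Ipos by simp
  qed
  moreover have "(LINT x|lborel. F x) / (1 + \<eta> * barrier (0::'a)) \<le> (LINT x|lborel. F x / F 0)"
  proof -
    have "(LINT x|lborel. F x) / (1 + \<eta> * barrier (0::'a)) \<le> (LINT x|lborel. F x) / F 0"
      using positive_definite_integral_nonneg[OF Fcont Fpd Fint] F0 by (intro divide_left_mono) auto
    then show ?thesis by simp
  qed
  ultimately show ?thesis
    by (metis ereal_less_eq(3) order_trans)
qed

lemma delsarte_le_bandlimited:
  "delsarte_const (ball (0::'a::euclidean_space) 1) \<le> bandlimited_delsarte_const (ball (0::'a) 1)"
  unfolding delsarte_const_def
proof (rule SUP_least)
  fix f :: "'a \<Rightarrow> real" assume f: "f \<in> delsarte_class (ball 0 1)"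
  let ?J = "LINT x|lborel. f x" and ?G = "LINT x|lborel. barrier (x::'a)"
  have "(\<lambda>n. inverse (real (Suc n))) \<longlonglongrightarrow> 0" by (rule LIMSEQ_inverse_real_of_nat)
  then have "(\<lambda>n. (?J + inverse (real (Suc n)) * ?G) / (1 + inverse (real (Suc n)) * barrier (0::'a)))
      \<longlonglongrightarrow> (?J + 0 * ?G) / (1 + 0 * barrier (0::'a))"
    by (intro tendsto_intros) auto
  then have "(\<lambda>n. ereal ((?J + inverse (real (Suc n)) * ?G) / (1 + inverse (real (Suc n)) * barrier (0::'a))))
      \<longlonglongrightarrow> ereal ((?J + 0 * ?G) / (1 + 0 * barrier (0::'a)))"
    by (rule tendsto_ereal)
  then have "ereal ((?J + 0 * ?G) / (1 + 0 * barrier (0::'a))) \<le> bandlimited_delsarte_const (ball (0::'a) 1)"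
  proof (rule LIMSEQ_le_const2)
    show "\<exists>N. \<forall>n\<ge>N. ereal ((?J + inverse (real (Suc n)) * ?G) / (1 + inverse (real (Suc n)) * barrier (0::'a)))
        \<le> bandlimited_delsarte_const (ball (0::'a) 1)"
      using bandlimited_perturbation_bound[OF f, of "inverse (real (Suc _))"] by (intro exI[of _ 0] allI impI) simp
  qed
  then show "ereal ?J \<le> bandlimited_delsarte_const (ball (0::'a) 1)" by simp
qed

theorem proposition3p2:
  "bandlimited_delsarte_const (ball 0 1 :: (real ^ 'd) set) =
   delsarte_const (ball 0 1 :: (real ^ 'd) set)"
  by (intro antisym bandlimited_le_delsarte delsarte_le_bandlimited) simp

end
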